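(* Let $G$ be a connected graph (no loops, no multiple edges), $b\in V_G$, $\ell\in\mathbb{Z}_{\ge0}$. The bijection $\Sigma:\mathcal{V}_{G,b,\ell}\to\mathcal{L}_{\mathrm{con}}(\operatorname{IP}_{G,b,\ell})$ extends to an isomorphism of cubical complexes $\hat\Sigma:\mathcal{S}_{G,b,\ell}\to\mathcal{X}(\operatorname{IP}_{G,b,\ell})$; that is, a set $Y$ of configurations is the vertex set of a cube of $\mathcal{S}_{G,b,\ell}$ if and only if $\Sigma(Y)$ is the vertex set of a cube of $\mathcal{X}(\operatorname{IP}_{G,b,\ell})$.
   Context: $G$-paths: length $\#\mathbf{p}$, edges $\mathbf{p}_i=\{p_{i-1},p_i\}\in E_G$, vertices $p_0,\dots,p_{\#\mathbf{p}}$; $\preceq^{\mathrm{pre}}$ is the prefix order; cycle-free means distinct vertices. For $\#\mathbf{p}>0$, $\mathbf{p}=\mathbf{p}^{(1)}\cdots\mathbf{p}^{(n_{\mathbf{p}})}$ is the unique factorization into positive-length paths with each $\mathbf{p}^{(t)}$ the longest cycle-free suffix of $\mathbf{p}^{(1)}\cdots\mathbf{p}^{(t)}$; $d_{\mathbf{p}}(r)$ is the index of the block containing the $r$-th edge. PIP $\operatorname{IP}_{G,b,\ell}$: elements $\langle\mathbf{p},a\rangle$ with $\mathbf{p}$ a $G$-path, $p_0=b$, $\#\mathbf{p}>0$, $a\in\mathbb{Z}$, $0\le a\le\ell+1-\#\mathbf{p}-n_{\mathbf{p}}$; order $\langle\mathbf{p},a\rangle\preceq\langle\mathbf{q},c\rangle$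 iff $\mathbf{p}\preceq^{\mathrm{pre}}\mathbf{q}$ and $n_{\mathbf{p}}+a\ge d_{\mathbf{q}}(\#\mathbf{p})+c$; inconsistent iff neither path is a prefix of the other. For a PIP $\lambda$, $\mathcal{X}(\lambda)$ is the cubical complex whose vertices are the consistent lower sets (lower sets with no inconsistent pair) and where, for each consistent lower set $\mu$ and each set $K$ of maximal elements of $\mu$, the sets $\nu$ with $\mu\setminus K\subseteq\nu\subseteq\mu$ form the vertices of a $|K|$-cube. Workspace $W_G$: vertices $V_G\times\mathbb{Z}_{\ge0}$, $G(v,h)=v$, $\mathrm{ht}(v,h)=h$; horizontal edges $\{(v,h),(w,h)\}$ ($\{v,w\}\in E_G$), vertical edges $\{(v,h),(v,h+1)\}$. A configuration is a cycle-free $W_G$-path $\mathbf{x}$, vertices $x_0,\dots,x_\ell$, $x_0=(b,0)$, with weakly increasing heights; $\mathcal{V}_{G,b,\ell}$ is their set. Moves ($\{v,w\}\in E_G$, $h\ge0$): $\mathsf{T}^1_{v,w,h}$ applies to $\mathbf{x}$ with $x_{\ell-1}=(v,h)$, $x_\ell=(w,h)$ and replaces $x_\ell$ by $(v,h+1)$; $\mathsf{C}^1_{v,w,h}$ applies to $\mathbf{x}$ with $x_{j-1}=(v,h)$, $x_j=(w,h)$, $x_{j+1}=(w,h+1)$ for some $j$ and $(v,h+1)$ not a vertex of $\mathbf{x}$, and replaces $x_j$ by $(v,h+1)$; $\mathsf{T}^{-1}_{v,w,h},\mathsf{C}^{-1}_{v,w,h}$ are the inverse moves, applicable exactly to images of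 the upward ones. A set $\mathscr{A}$ of moves is commutative if for every configuration $\mathbf{x}$ to which all moves of $\mathscr{A}$ apply and every $\mathscr{S}\subseteq\mathscr{A}$, the moves of $\mathscr{S}$ can be applied successively to $\mathbf{x}$ in any order (each application legal), with result $\mathscr{S}\mathbf{x}$ independent of the order. The configuration space $\mathcal{S}_{G,b,\ell}$ is the cubical complex with vertex set $\mathcal{V}_{G,b,\ell}$ in which, for every commutative set $\mathscr{A}$ of $k$ moves and every $\mathbf{x}$ to which all moves of $\mathscr{A}$ apply, the $2^k$ configurations $\{\mathscr{S}\mathbf{x}:\mathscr{S}\subseteq\mathscr{A}\}$ form the vertices of a $k$-cube. For $\mathbf{x}\in\mathcal{V}_{G,b,\ell}$, with $i_1<\dots<i_t$ the indices of its horizontal edges, $\overline{\mathbf{x}}$ is the $G$-path with edges $G(\mathbf{x}_{i_1}),\dots,G(\mathbf{x}_{i_t})$ and $L_{\mathbf{x}}(r)$ is the height of $\mathbf{x}_{i_r}$; $\boldsymbol{\sigma}^{(\mathbf{x},i)}$ is the length-$i$ prefix of $\overline{\mathbf{x}}$, $a^{(\mathbf{x},i)}=L_{\mathbf{x}}(i)-n_{\boldsymbol{\sigma}^{(\mathbf{x},i)}}+1$, and $\Sigma(\mathbf{x})$ is the lower set of $\operatorname{IP}_{G,b,\ell}$ generated by $\langle\boldsymbol{\sigma}^{(\mathbf{x},i)},a^{(\mathbf{x},i)}\rangle$, $i=1,\dots,\#\overline{\mathbf{x}}$; $\Sigma$ is a bijection from $\mathcal{V}_{G,b,\ell}$ onto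 the consistent lower sets of $\operatorname{IP}_{G,b,\ell}$. *)

theory Defs
  imports "HOL-Library.Sublist"
begin

section \<open>Graphs and paths\<close>

record 'a ugraph =
  verts :: "'a set"
  edges :: "'a set set"

definition simple_graph :: "'a ugraph \<Rightarrow> bool" where
  "simple_graph G \<longleftrightarrow>
     (\<forall>e \<in> edges G. \<exists>u v. e = {u, v} \<and> u \<noteq> v \<and> u \<in> verts G \<and> v \<in> verts G)"

text \<open>A path is represented by its nonempty list of vertices; since there are no multiple edges,
  this determines the edges. For nonempty vertex lists, prefixes and suffixes of paths are
  prefixes and suffixes of lists, and a path is cycle-free iff its vertex list is distinct.\<close>

definition is_path :: "'a ugraph \<Rightarrow> 'a list \<Rightarrow> bool" where
  "is_path G p \<longleftrightarrow>
     p \<noteq> [] \<and> set p \<subseteq> verts G \<and> successively (\<lambda>u v. {u, v} \<in> edges G) p"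

definition plen :: "'a list \<Rightarrow> nat" where
  "plen p = length p - 1"

definition connected_graph :: "'a ugraph \<Rightarrow> bool" where
  "connected_graph G \<longleftrightarrow> verts G \<noteq> {} \<and>
     (\<forall>u \<in> verts G. \<forall>v \<in> verts G. \<exists>p. is_path G p \<and> hd p = u \<and> last p = v)"

section \<open>The cycle-free factorization of a path\<close>

definition longest_cycle_free_suffix :: "'a list \<Rightarrow> 'a list \<Rightarrow> bool" where
  "longest_cycle_free_suffix q p \<longleftrightarrow>
     suffix q p \<and> distinct q \<and> (\<forall>q'. suffix q' p \<and> distinct q' \<longrightarrow> length q' \<le> length q)"

text \<open>Composition of a nonempty list of paths, each starting where its predecessor ends: the
  shared vertices are listed only once.\<close>

definition path_prod :: "'a list list \<Rightarrow> 'a list" where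
  "path_prod ps = hd (hd ps) # concat (map tl ps)"

definition is_factorization :: "'a list list \<Rightarrow> 'a list \<Rightarrow> bool" where
  "is_factorization ps p \<longleftrightarrow>
     ps \<noteq> [] \<and> (\<forall>q \<in> set ps. 0 < plen q) \<and>
     successively (\<lambda>q r. last q = hd r) ps \<and>
     path_prod ps = p \<and>
     (\<forall>t \<in> {1..length ps}. longest_cycle_free_suffix (ps ! (t - 1)) (path_prod (take t ps)))"

text \<open>Meaningful only for paths of positive length in a loopless graph, where the factorization
  exists and is unique.\<close>

definition factorization :: "'a list \<Rightarrow> 'a list list" where
  "factorization p = (THE ps. is_factorization ps p)"

definition nblocks :: "'a list \<Rightarrow> nat" where
  "nblocks p = length (factorization p)"

text \<open>The (1-based) index of the block containing the \<open>r\<close>-th edge, for \<open>1 \<le> r \<le> plen p\<close>.\<close>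

definition block_index :: "'a list \<Rightarrow> nat \<Rightarrow> nat" where
  "block_index p r = (LEAST t. r \<le> sum_list (map plen (take t (factorization p))))"

section \<open>Cubical complexes, posets with inconsistent pairs\<close>

text \<open>A cubical complex is recorded by its vertices and, for each \<open>k\<close>, the vertex sets of its
  \<open>k\<close>-cubes.\<close>

record 'v cubical_complex =
  cverts :: "'v set"
  ccubes :: "nat \<Rightarrow> 'v set set"

definition cubical_iso :: "('v \<Rightarrow> 'w) \<Rightarrow> 'v cubical_complex \<Rightarrow> 'w cubical_complex \<Rightarrow> bool" where
  "cubical_iso f X Y \<longleftrightarrow>
     bij_betw f (cverts X) (cverts Y) \<and>
     (\<forall>k. \<forall>S \<subseteq> cverts X. S \<in> ccubes X k \<longleftrightarrow> f ` S \<in> ccubes Y k)"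

record 'e pip =
  elems :: "'e set"
  le :: "'e \<Rightarrow> 'e \<Rightarrow> bool"
  incons :: "'e \<Rightarrow> 'e \<Rightarrow> bool"

definition con_lower_sets :: "'e pip \<Rightarrow> 'e set set" where
  "con_lower_sets P = {M. M \<subseteq> elems P \<and>
     (\<forall>x \<in> M. \<forall>y \<in> elems P. le P y x \<longrightarrow> y \<in> M) \<and>
     (\<forall>x \<in> M. \<forall>y \<in> M. \<not> incons P x y)}"

definition maximal_elems :: "'e pip \<Rightarrow> 'e set \<Rightarrow> 'e set" where
  "maximal_elems P M = {x \<in> M. \<forall>y \<in> M. le P x y \<longrightarrow> y = x}"

definition pip_complex :: "'e pip \<Rightarrow> 'e set cubical_complex" where
  "pip_complex P = \<lparr>
     cverts = con_lower_sets P,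
     ccubes = (\<lambda>k. {{N. M - K \<subseteq> N \<and> N \<subseteq> M} | M K.
       M \<in> con_lower_sets P \<and> K \<subseteq> maximal_elems P M \<and> finite K \<and> card K = k}) \<rparr>"

section \<open>The PIP of a graph\<close>

definition IP_elems :: "'a ugraph \<Rightarrow> 'a \<Rightarrow> nat \<Rightarrow> ('a list \<times> int) set" where
  "IP_elems G b l = {(p, a). is_path G p \<and> hd p = b \<and> 0 < plen p \<and>
     0 \<le> a \<and> a \<le> int l + 1 - int (plen p) - int (nblocks p)}"

fun IP_le :: "'a list \<times> int \<Rightarrow> 'a list \<times> int \<Rightarrow> bool" where
  "IP_le (p, a) (q, c) \<longleftrightarrow>
     prefix p q \<and> int (nblocks p) + a \<ge> int (block_index q (plen p)) + c"

fun IP_incons :: "'a list \<times> int \<Rightarrow> 'a list \<times> int \<Rightarrow> bool" where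
  "IP_incons (p, a) (q, c) \<longleftrightarrow> \<not> prefix p q \<and> \<not> prefix q p"

definition IP :: "'a ugraph \<Rightarrow> 'a \<Rightarrow> nat \<Rightarrow> ('a list \<times> int) pip" where
  "IP G b l = \<lparr> elems = IP_elems G b l, le = IP_le, incons = IP_incons \<rparr>"

section \<open>Workspace, configurations and moves\<close>

definition workspace :: "'a ugraph \<Rightarrow> ('a \<times> nat) ugraph" where
  "workspace G = \<lparr>
     verts = verts G \<times> UNIV,
     edges = {{(v, h), (w, h)} | v w h. {v, w} \<in> edges G}
           \<union> {{(v, h), (v, h + 1)} | v h. v \<in> verts G} \<rparr>"

definition configs :: "'a ugraph \<Rightarrow> 'a \<Rightarrow> nat \<Rightarrow> ('a \<times> nat) list set" where
  "configs G b l = {x. is_path (workspace G) x \<and> distinct x \<and> plen x = l \<and>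
     hd x = (b, 0) \<and> sorted (map snd x)}"

datatype 'a move =
    T_up 'a 'a nat
  | C_up 'a 'a nat
  | T_down 'a 'a nat
  | C_down 'a 'a nat

definition moves :: "'a ugraph \<Rightarrow> 'a move set" where
  "moves G = {M v w h | M v w h. M \<in> {T_up, C_up, T_down, C_down} \<and> {v, w} \<in> edges G}"

definition T_step ::
  "'a ugraph \<Rightarrow> 'a \<Rightarrow> nat \<Rightarrow> 'a \<Rightarrow> 'a \<Rightarrow> nat \<Rightarrow>
    ('a \<times> nat) list \<Rightarrow> ('a \<times> nat) list \<Rightarrow> bool" where
  "T_step G b l v w h x y \<longleftrightarrow> x \<in> configs G b l \<and>
     1 \<le> l \<and> x ! (l - 1) = (v, h) \<and> x ! l = (w, h) \<and> y = x[l := (v, h + 1)]"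

definition C_step ::
  "'a ugraph \<Rightarrow> 'a \<Rightarrow> nat \<Rightarrow> 'a \<Rightarrow> 'a \<Rightarrow> nat \<Rightarrow>
    ('a \<times> nat) list \<Rightarrow> ('a \<times> nat) list \<Rightarrow> bool" where
  "C_step G b l v w h x y \<longleftrightarrow> x \<in> configs G b l \<and>
     (\<exists>j. 1 \<le> j \<and> j < l \<and> x ! (j - 1) = (v, h) \<and> x ! j = (w, h) \<and> x ! (j + 1) = (w, h + 1) \<and>
          (v, h + 1) \<notin> set x \<and> y = x[j := (v, h + 1)])"

text \<open>\<open>move_step G b l m x y\<close>: the move \<open>m\<close> applies to the configuration \<open>x\<close>, with result \<open>y\<close>.
  The downward moves are the converses of the upward ones.\<close>

fun move_step ::
  "'a ugraph \<Rightarrow> 'a \<Rightarrow> nat \<Rightarrow> 'a move \<Rightarrow> ('a \<times> nat) list \<Rightarrow> ('a \<times> nat) list \<Rightarrow> bool" where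
  "move_step G b l (T_up v w h) x y \<longleftrightarrow> T_step G b l v w h x y"
| "move_step G b l (C_up v w h) x y \<longleftrightarrow> C_step G b l v w h x y"
| "move_step G b l (T_down v w h) x y \<longleftrightarrow> T_step G b l v w h y x"
| "move_step G b l (C_down v w h) x y \<longleftrightarrow> C_step G b l v w h y x"

definition applicable :: "'a ugraph \<Rightarrow> 'a \<Rightarrow> nat \<Rightarrow> 'a move \<Rightarrow> ('a \<times> nat) list \<Rightarrow> bool" where
  "applicable G b l m x \<longleftrightarrow> (\<exists>y. move_step G b l m x y)"

fun run_moves ::
  "'a ugraph \<Rightarrow> 'a \<Rightarrow> nat \<Rightarrow> 'a move list \<Rightarrow> ('a \<times> nat) list \<Rightarrow> ('a \<times> nat) list \<Rightarrow> bool" where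
  "run_moves G b l [] x y \<longleftrightarrow> y = x"
| "run_moves G b l (m # ms) x z \<longleftrightarrow> (\<exists>y. move_step G b l m x y \<and> run_moves G b l ms y z)"

text \<open>For a finite set \<open>S\<close> of moves: all moves of \<open>S\<close> can be applied successively to \<open>x\<close> in any
  order, always with result \<open>y\<close>. (Moves are deterministic, so there is at most one such \<open>y\<close>.)\<close>

definition set_result ::
  "'a ugraph \<Rightarrow> 'a \<Rightarrow> nat \<Rightarrow> 'a move set \<Rightarrow> ('a \<times> nat) list \<Rightarrow> ('a \<times> nat) list \<Rightarrow> bool" where
  "set_result G b l S x y \<longleftrightarrow> (\<forall>ms. distinct ms \<and> set ms = S \<longrightarrow> run_moves G b l ms x y)"

definition commutative_moves :: "'a ugraph \<Rightarrow> 'a \<Rightarrow> nat \<Rightarrow> 'a move set \<Rightarrow> bool" where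
  "commutative_moves G b l A \<longleftrightarrow> finite A \<and>
     (\<forall>x \<in> configs G b l. (\<forall>m \<in> A. applicable G b l m x) \<longrightarrow>
        (\<forall>S \<subseteq> A. \<exists>y. set_result G b l S x y))"

definition config_space :: "'a ugraph \<Rightarrow> 'a \<Rightarrow> nat \<Rightarrow> ('a \<times> nat) list cubical_complex" where
  "config_space G b l = \<lparr>
     cverts = configs G b l,
     ccubes = (\<lambda>k. {{y. \<exists>S \<subseteq> A. set_result G b l S x y} | A x.
       A \<subseteq> moves G \<and> commutative_moves G b l A \<and> card A = k \<and>
       x \<in> configs G b l \<and> (\<forall>m \<in> A. applicable G b l m x)}) \<rparr>"

section \<open>The map from configurations to consistent lower sets\<close>

definition hor_indices :: "('a \<times> nat) list \<Rightarrow> nat list" where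
  "hor_indices x = filter (\<lambda>i. snd (x ! (i - 1)) = snd (x ! i)) [1..<length x]"

text \<open>In a configuration, between two successive horizontal edges there are only vertical edges,
  which do not change the \<open>G\<close>-component; so the projected path is given by its start vertex
  followed by the \<open>G\<close>-components of the endpoints of the horizontal edges.\<close>

definition proj_path :: "('a \<times> nat) list \<Rightarrow> 'a list" where
  "proj_path x = fst (hd x) # map (\<lambda>i. fst (x ! i)) (hor_indices x)"

definition hor_height :: "('a \<times> nat) list \<Rightarrow> nat \<Rightarrow> nat" where
  "hor_height x r = snd (x ! (hor_indices x ! (r - 1)))"

definition path_prefix :: "('a \<times> nat) list \<Rightarrow> nat \<Rightarrow> 'a list" where
  "path_prefix x i = take (i + 1) (proj_path x)"

definition Sigma_gen :: "('a \<times> nat) list \<Rightarrow> nat \<Rightarrow> 'a list \<times> int" where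
  "Sigma_gen x i =
     (path_prefix x i, int (hor_height x i) - int (nblocks (path_prefix x i)) + 1)"

definition Sigma_map :: "'a ugraph \<Rightarrow> 'a \<Rightarrow> nat \<Rightarrow> ('a \<times> nat) list \<Rightarrow> ('a list \<times> int) set" where
  "Sigma_map G b l x =
     {e \<in> elems (IP G b l). \<exists>i \<in> {1..plen (proj_path x)}. le (IP G b l) e (Sigma_gen x i)}"

end

theory Submission
  imports Defs
begin

text \<open>
  Write \<open>H = a + n\<^sub>p - 1\<close> for the height of an element \<open>\<langle>p, a\<rangle>\<close>, and let \<open>c(q, r)\<close> be the number of
  cuts of the factorization of \<open>q\<close> after its \<open>r\<close>-th edge. Then \<open>\<langle>p, a\<rangle> \<preceq> \<langle>q, a'\<rangle>\<close> iff \<open>p\<close> is a prefix of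
  \<open>q\<close> and \<open>H\<^sub>q \<le> H\<^sub>p + c(q, #p)\<close>. A configuration is a path together with a height \<open>L(i)\<close> for each
  edge, and it is cycle-free and weakly increasing iff \<open>L(i) + c(\<sigma>\<^sub>j, i) \<le> L(j)\<close> for all \<open>i \<le> j\<close>, where
  \<open>\<sigma>\<^sub>j\<close> is the prefix of length \<open>j\<close>. Hence the lower set of a configuration consists of all
  \<open>(\<sigma>\<^sub>i, H)\<close> with \<open>L(i) \<le> H \<le> l - i\<close>, and every consistent lower set has this form.

  An upward move removes one maximal element from the lower set, every maximal element can be
  removed, and the label of the move is determined by the removed element. So every set of upward
  moves is commutative, which gives all cubes of the PIP. Conversely, in a commutative set of moves
  each move toggles the same element regardless of the order, since a move and its inverse are
  never both applicable; the toggled elements are then maximal in the largest lower set reached.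
\<close>

section \<open>The cycle-free factorization\<close>

text \<open>The vertex index at which the longest cycle-free suffix starts, hence also the number of
  edges before the last block.\<close>

definition cf_start :: "'a list \<Rightarrow> nat" where
  "cf_start p = (LEAST s. distinct (drop s p))"

text \<open>Suffixes of distinct lists are distinct, so the admissible starts form an up-set with
  least element \<open>cf_start p\<close>.\<close>

lemma distinct_drop_iff: "distinct (drop s p) \<longleftrightarrow> cf_start p \<le> s"
proof
  show "distinct (drop s p) \<Longrightarrow> cf_start p \<le> s"
    unfolding cf_start_def by (rule Least_le)
  have "distinct (drop (length p) p)" by simp
  then have d: "distinct (drop (cf_start p) p)"
    unfolding cf_start_def by (rule LeastI)
  assume "cf_start p \<le> s"
  then have "drop s p = drop (s - cf_start p) (drop (cf_start p) p)" by simp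
  with d show "distinct (drop s p)" by (metis distinct_drop)
qed

lemma cf_start_le_length: "cf_start p \<le> length p"
  by (simp flip: distinct_drop_iff)

text \<open>The last edge alone is cycle-free, so the last block has positive length and splitting
  it off makes progress.\<close>

lemma cf_start_less_plen:
  assumes "successively (\<noteq>) p" "2 \<le> length p"
  shows "Suc (cf_start p) < length p"
proof -
  obtain n where n: "length p = Suc (Suc n)"
    using assms(2) by (metis Suc_le_D numeral_2_eq_2 Suc_le_mono)
  have "drop n p = [p ! n, p ! Suc n]"
    using n by (simp flip: Cons_nth_drop_Suc)
  moreover have "p ! n \<noteq> p ! Suc n"
    using assms(1) n by (simp add: successively_conv_nth)
  ultimately have "distinct (drop n p)" by simp
  then show ?thesis using n by (simp add: distinct_drop_iff)
qed

lemma longest_cycle_free_suffix_iff: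
  "longest_cycle_free_suffix q p \<longleftrightarrow> q = drop (cf_start p) p"
proof
  assume q: "longest_cycle_free_suffix q p"
  then have s: "suffix q p" and d: "distinct q"
    and m: "\<And>q'. suffix q' p \<Longrightarrow> distinct q' \<Longrightarrow> length q' \<le> length q"
    by (auto simp: longest_cycle_free_suffix_def)
  have qd: "q = drop (length p - length q) p"
    using s by (auto simp: suffix_def)
  have "cf_start p \<le> length p - length q"
    using d qd by (metis distinct_drop_iff)
  moreover have "length (drop (cf_start p) p) \<le> length q"
    by (intro m suffix_drop) (simp add: distinct_drop_iff)
  ultimately have "cf_start p = length p - length q"
    using suffix_length_le[OF s] by simp
  then show "q = drop (cf_start p) p" using qd by simp
next
  assume q: "q = drop (cf_start p) p"
  have "length q' \<le> length q" if s: "suffix q' p" and "distinct q'" for q'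
  proof -
    have "q' = drop (length p - length q') p" using s by (auto simp: suffix_def)
    then have "cf_start p \<le> length p - length q'"
      using \<open>distinct q'\<close> by (metis distinct_drop_iff)
    then show ?thesis using q suffix_length_le[OF s] by simp
  qed
  then show "longest_cycle_free_suffix q p"
    using q by (simp add: longest_cycle_free_suffix_def suffix_drop distinct_drop_iff)
qed

text \<open>The factorization is computed from the end, by splitting off the longest cycle-free suffix.\<close>

function greedy :: "'a list \<Rightarrow> 'a list list" where
  "greedy p = (if length p \<le> Suc (cf_start p) then []
     else greedy (take (Suc (cf_start p)) p) @ [drop (cf_start p) p])"
  by auto
termination by (relation "measure length") auto

declare greedy.simps[simp del]

section \<open>Existence and uniqueness of the factorization\<close>

lemma successively_take: "successively R p \<Longrightarrow> successively R (take n p)"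
  by (simp add: successively_conv_nth)

lemma path_prod_snoc:
  "ps \<noteq> [] \<Longrightarrow> path_prod (ps @ [q]) = path_prod ps @ tl q"
  by (simp add: path_prod_def)

lemma last_path_prod:
  assumes "ps \<noteq> []" "\<forall>q \<in> set ps. 0 < plen q"
  shows "last (path_prod ps) = last (last ps)"
proof -
  obtain qs q where ps: "ps = qs @ [q]" using assms(1) by (metis rev_exhaust)
  have "tl q \<noteq> []" using assms(2) ps by (cases q rule: remdups_adj.cases) (auto simp: plen_def)
  then have "last (tl q) = last q" by (simp add: last_tl)
  then show ?thesis using \<open>tl q \<noteq> []\<close> ps by (simp add: path_prod_def)
qed

text \<open>The conditions on the earlier blocks involve only \<open>qs\<close>, so only the
  condition on the last block is new. Existence and uniqueness then both go by splitting off the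
  last block.\<close>

lemma is_factorization_snoc:
  assumes "qs \<noteq> []"
  shows "is_factorization (qs @ [q]) p \<longleftrightarrow>
     is_factorization qs (path_prod qs) \<and> 0 < plen q \<and> last (last qs) = hd q \<and>
     path_prod qs @ tl q = p \<and> q = drop (cf_start p) p"
proof -
  have *: "{1..length (qs @ [q])} = insert (Suc (length qs)) {1..length qs}" by auto
  have "(\<forall>t \<in> {1..length (qs @ [q])}. longest_cycle_free_suffix ((qs @ [q]) ! (t - 1)) (path_prod (take t (qs @ [q])))) \<longleftrightarrow>
    longest_cycle_free_suffix q (path_prod (qs @ [q])) \<and>
    (\<forall>t \<in> {1..length qs}. longest_cycle_free_suffix (qs ! (t - 1)) (path_prod (take t qs)))"
    unfolding * by (auto simp: nth_append)
  then show ?thesis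
    using assms
    unfolding is_factorization_def longest_cycle_free_suffix_iff
    by (auto simp: successively_append_iff path_prod_snoc)
qed

lemma is_factorization_single:
  "is_factorization [q] p \<longleftrightarrow> 0 < plen q \<and> q = p \<and> distinct p"
proof -
  have "hd q # tl q = q" if "0 < plen q"
    using that by (cases q) (auto simp: plen_def)
  moreover have "p = drop (cf_start p) p \<longleftrightarrow> distinct p" if "0 < plen p"
  proof -
    have "p = drop (cf_start p) p \<longleftrightarrow> cf_start p = 0"
    proof
      assume "p = drop (cf_start p) p"
      then have "length p = length p - cf_start p" by (metis length_drop)
      then show "cf_start p = 0" using that by (simp add: plen_def)
    qed simp
    then show ?thesis using distinct_drop_iff[of 0 p] by simp
  qed
  ultimately show ?thesis
    unfolding is_factorization_def longest_cycle_free_suffix_iff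
    by (auto simp: path_prod_def)
qed

lemma is_factorization_greedy:
  assumes "successively (\<noteq>) p" "2 \<le> length p"
  shows "is_factorization (greedy p) p"
  using assms
proof (induction "length p" arbitrary: p rule: less_induct)
  case less
  let ?c = "cf_start p" and ?q = "take (Suc (cf_start p)) p"
  have c: "Suc ?c < length p" by (rule cf_start_less_plen[OF less.prems])
  then have g: "greedy p = greedy ?q @ [drop ?c p]" by (subst greedy.simps) simp
  show ?case
  proof (cases "?c = 0")
    case True
    then have "greedy ?q = []"
      by (subst greedy.simps) simp
    then show ?thesis using True g c distinct_drop_iff[of 0 p]
      by (simp add: is_factorization_single plen_def)
  next
    case False
    have "is_factorization (greedy ?q) ?q"
      using less.prems c False by (intro less.hyps successively_take) auto
    then have f: "is_factorization (greedy ?q) (path_prod (greedy ?q))"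
      "path_prod (greedy ?q) = ?q" "greedy ?q \<noteq> []" "\<forall>q \<in> set (greedy ?q). 0 < plen q"
      by (auto simp: is_factorization_def)
    \<comment> \<open>The earlier blocks and the last one share the vertex with index
      \<open>?c\<close>, which is why the recursion keeps \<open>Suc ?c\<close> vertices.\<close>
    have "last (last (greedy ?q)) = p ! ?c"
      using last_path_prod[OF f(3,4)] f(2) c by (simp add: take_Suc_conv_app_nth)
    also have "\<dots> = hd (drop ?c p)" using c by (simp add: hd_drop_conv_nth)
    finally show ?thesis
      unfolding g is_factorization_snoc[OF f(3)] using f c by (simp add: plen_def tl_drop flip: drop_Suc)
  qed
qed

text \<open>The last block must be the suffix from \<open>cf_start p\<close> on. This fixes the
  length of the product of the others, which is therefore the prefix on which \<open>greedy\<close>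
  recurses.\<close>

lemma is_factorization_unique:
  assumes "is_factorization ps p"
  shows "ps = greedy p"
  using assms
proof (induction ps arbitrary: p rule: rev_induct)
  case Nil
  then show ?case by (simp add: is_factorization_def)
next
  case (snoc q qs)
  show ?case
  proof (cases "qs = []")
    case True
    then have "0 < plen q" "q = p" "distinct p"
      using snoc.prems by (auto simp: is_factorization_single)
    then have "cf_start p = 0" using distinct_drop_iff[of 0 p] by simp
    moreover have "greedy (take (Suc 0) p) = []" by (subst greedy.simps) simp
    ultimately have "greedy p = [p]"
      using \<open>0 < plen q\<close> \<open>q = p\<close> by (subst greedy.simps) (auto simp: plen_def)
    then show ?thesis using True \<open>q = p\<close> by simp
  next
    case False
    note f = snoc.prems[unfolded is_factorization_snoc[OF False]]
    have q: "q = drop (cf_start p) p" and qp: "path_prod qs @ tl q = p" and "0 < plen q"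
      using f by auto
    then have c: "Suc (cf_start p) < length p" by (auto simp: plen_def)
    have "length (path_prod qs) = Suc (cf_start p)"
      using arg_cong[OF qp, of length] q c by simp
    then have "path_prod qs = take (Suc (cf_start p)) p"
      using qp by (metis append_eq_conv_conj)
    moreover have "qs = greedy (path_prod qs)" using f snoc.IH by blast
    ultimately show ?thesis using q c by (subst greedy.simps) simp
  qed
qed

lemma factorization_eq_greedy:
  assumes "successively (\<noteq>) p" "2 \<le> length p"
  shows "factorization p = greedy p"
  unfolding factorization_def
  using is_factorization_greedy[OF assms] is_factorization_unique by (intro the_equality) auto

text \<open>With edges numbered from 1, the last block contains edge \<open>r\<close> exactly if
  \<open>cf_start p < r\<close>. Otherwise the boundary at vertex \<open>cf_start p\<close> is one
  cut, and counting goes on in the prefix ending there.\<close>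

function cuts :: "'a list \<Rightarrow> nat \<Rightarrow> nat" where
  "cuts p r = (if length p \<le> Suc (cf_start p) \<or> cf_start p < r then 0
     else Suc (cuts (take (Suc (cf_start p)) p) r))"
  by auto
termination by (relation "measure (length \<circ> fst)") auto

declare cuts.simps[simp del]

lemma cuts_take_Suc:
  assumes "Suc (cf_start (take n p)) < n" "n \<le> length p" "r \<le> cf_start (take n p)"
  shows "cuts (take n p) r = Suc (cuts (take (Suc (cf_start (take n p))) p) r)"
proof -
  have "take (Suc (cf_start (take n p))) (take n p) = take (Suc (cf_start (take n p))) p"
    using assms(1) by (simp add: min_def)
  moreover have "length (take n p) = n" using assms(2) by simp
  ultimately show ?thesis
    using assms(1,3) cuts.simps[of "take n p" r] by (metis leD)
qed

text \<open>Every cut lies after the first edge, and the cuts separate the blocks.\<close>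

lemma nblocks_eq:
  assumes "successively (\<noteq>) p" "2 \<le> length p"
  shows "nblocks p = Suc (cuts p 1)"
proof -
  have "length (greedy p) = Suc (cuts p 1)"
    using assms
  proof (induction "length p" arbitrary: p rule: less_induct)
    case less
    let ?q = "take (Suc (cf_start p)) p"
    have c: "Suc (cf_start p) < length p" by (rule cf_start_less_plen[OF less.prems])
    then have g: "greedy p = greedy ?q @ [drop (cf_start p) p]" by (subst greedy.simps) simp
    show ?case
    proof (cases "cf_start p = 0")
      case True
      then have "greedy ?q = []" by (subst greedy.simps) simp
      then show ?thesis using g True by (subst cuts.simps) simp
    next
      case False
      then have "length (greedy ?q) = Suc (cuts ?q 1)"
        using c less.prems by (intro less.hyps successively_take) auto
      then show ?thesis using g c False by (subst cuts.simps) simp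
    qed
  qed
  then show ?thesis by (simp add: nblocks_def factorization_eq_greedy[OF assms])
qed

lemma sum_plen_greedy:
  assumes "successively (\<noteq>) p"
  shows "sum_list (map plen (greedy p)) = plen p"
  using assms
proof (induction "length p" arbitrary: p rule: less_induct)
  case less
  show ?case
  proof (cases "2 \<le> length p")
    case True
    let ?q = "take (Suc (cf_start p)) p"
    have c: "Suc (cf_start p) < length p" by (rule cf_start_less_plen[OF less.prems True])
    then have g: "greedy p = greedy ?q @ [drop (cf_start p) p]" by (subst greedy.simps) simp
    have "sum_list (map plen (greedy ?q)) = plen ?q"
      using c less.prems by (intro less.hyps successively_take) auto
    then show ?thesis using g c by (simp add: plen_def)
  next
    case False
    then show ?thesis by (subst greedy.simps) (simp add: plen_def)
  qed
qed

text \<open>The blocks behind the one containing edge \<open>r\<close> correspond to the cuts after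
  that edge. This trades \<open>block_index\<close> in the order of the PIP for
  \<open>cuts\<close>.\<close>

lemma block_index_eq:
  assumes "successively (\<noteq>) p" "1 \<le> r" "r \<le> plen p"
  shows "block_index p r + cuts p r = nblocks p"
proof -
  let ?s = "\<lambda>p t. sum_list (map plen (take t (greedy p)))"
  \<comment> \<open>The two inequalities say that \<open>n\<close> is the least index sought, in a
    form suited to the induction.\<close>
  have "\<exists>n. n + cuts p r = length (greedy p) \<and> r \<le> ?s p n \<and> (\<forall>t<n. ?s p t < r)"
    using assms
  proof (induction "length p" arbitrary: p rule: less_induct)
    case less
    let ?q = "take (Suc (cf_start p)) p"
    have c: "Suc (cf_start p) < length p"
      using less.prems by (intro cf_start_less_plen) (auto simp: plen_def)
    then have g: "greedy p = greedy ?q @ [drop (cf_start p) p]" by (subst greedy.simps) simp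
    have w: "successively (\<noteq>) ?q" using less.prems(1) by (rule successively_take)
    show ?case
    proof (cases "cf_start p < r")
      case True
      have "?s p t < r" if "t < length (greedy p)" for t
      proof -
        have t: "t \<le> length (greedy ?q)" using that g by simp
        have "?s p t \<le> sum_list (map plen (greedy ?q))"
          unfolding g using t
          by (simp, metis append_take_drop_id le_add1 map_append sum_list_append)
        also have "\<dots> = cf_start p" using sum_plen_greedy[OF w] c by (simp add: plen_def)
        finally show ?thesis using True by simp
      qed
      moreover have "cuts p r = 0" using True by (subst cuts.simps) simp
      ultimately show ?thesis
        using sum_plen_greedy[OF less.prems(1)] less.prems(3)
        by (intro exI[of _ "length (greedy p)"]) auto
    next
      case False
      have "r \<le> plen ?q" using False c by (simp add: plen_def)
      then obtain n where n: "n + cuts ?q r = length (greedy ?q)" "r \<le> ?s ?q n" "\<forall>t<n. ?s ?q t < r"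
        using less.hyps[of ?q] w less.prems(2) c by auto
      have "cuts p r = Suc (cuts ?q r)" using False c by (subst cuts.simps) simp
      \<comment> \<open>Up to \<open>t = n\<close> only blocks of \<open>?q\<close> are taken, so
        the appended last block does not enter the sums.\<close>
      moreover have "?s p t = ?s ?q t" if "t \<le> n" for t
        unfolding g using that n(1) by simp
      ultimately show ?thesis using n g by (intro exI[of _ n]) auto
    qed
  qed
  then obtain n where n: "n + cuts p r = length (greedy p)" "r \<le> ?s p n" "\<forall>t<n. ?s p t < r"
    by blast
  have f: "factorization p = greedy p"
    using assms by (intro factorization_eq_greedy) (auto simp: plen_def)
  have "block_index p r = n"
    unfolding block_index_def f using n(2,3) by (intro Least_equality) (auto simp: not_less[symmetric])
  then show ?thesis using n(1) f by (simp add: nblocks_def)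
qed

section \<open>Cuts of a path and of its prefixes\<close>

lemma cuts_eq_0D:
  assumes "cuts p r = 0" "successively (\<noteq>) p" "2 \<le> length p"
  shows "cf_start p < r"
  using assms(1) cf_start_less_plen[OF assms(2,3)] by (subst (asm) cuts.simps) (auto split: if_splits)

lemma cf_start_take_mono:
  assumes "m \<le> n"
  shows "cf_start (take m p) \<le> cf_start (take n p)"
proof -
  have "distinct (drop (cf_start (take n p)) (take n p))" by (simp add: distinct_drop_iff)
  \<comment> \<open>From the same start, the shorter prefix shows an initial part of a cycle-free
    list.\<close>
  then have "distinct (take (m - cf_start (take n p)) (drop (cf_start (take n p)) (take n p)))"
    by (rule distinct_take)
  also have "take (m - cf_start (take n p)) (drop (cf_start (take n p)) (take n p)) =
      drop (cf_start (take n p)) (take m p)"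
    using assms by (simp add: drop_take min_def)
  finally show ?thesis by (simp add: distinct_drop_iff)
qed

text \<open>A prefix may be cut at other places than the longer path. By
  \<open>cf_start_take_mono\<close> its last block starts no later than that of the longer one, and
  induction compares what precedes the two starts.\<close>

lemma cuts_take_mono:
  assumes "successively (\<noteq>) p" "m \<le> n" "n \<le> length p" "1 \<le> r"
  shows "cuts (take m p) r \<le> cuts (take n p) r"
  using assms(2,3)
proof (induction m arbitrary: n rule: less_induct)
  case (less m)
  show ?case
  proof (cases "length (take m p) \<le> Suc (cf_start (take m p)) \<or> cf_start (take m p) < r")
    case True
    then show ?thesis by (subst cuts.simps) simp
  next
    case False
    let ?c = "cf_start (take m p)" and ?d = "cf_start (take n p)"
    have cd: "?c \<le> ?d" by (rule cf_start_take_mono[OF less.prems(1)])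
    have c: "Suc ?c < m" "Suc ?c < length p" using False by auto
    have d: "Suc ?d < n"
      using cf_start_less_plen[OF successively_take[OF assms(1)], of n] less.prems c by auto
    have "cuts (take m p) r = Suc (cuts (take (Suc ?c) p) r)"
      using False c by (subst cuts.simps) (simp add: min_def)
    also have "\<dots> \<le> Suc (cuts (take (Suc ?d) p) r)"
      using less.IH[of "Suc ?c" "Suc ?d"] c cd d less.prems by simp
    also have "\<dots> = cuts (take n p) r"
      using False cd d less.prems by (intro cuts_take_Suc[symmetric]) auto
    finally show ?thesis .
  qed
qed

text \<open>Makes the element below \<open>(\<sigma>\<^sub>j, H)\<close> with path \<open>\<sigma>\<^sub>i\<close> and height \<open>H - c(\<sigma>\<^sub>j, i)\<close> satisfy \<open>a \<ge> 0\<close>.\<close>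

lemma cuts_superadditive:
  assumes "successively (\<noteq>) p" "1 \<le> i" "i \<le> j" "Suc j \<le> length p"
  shows "cuts (take (Suc j) p) i + cuts (take (Suc i) p) 1 \<le> cuts (take (Suc j) p) 1"
  using assms(3,4)
proof (induction j rule: less_induct)
  case (less j)
  let ?d = "cf_start (take (Suc j) p)"
  have d: "?d < j"
    using cf_start_less_plen[OF successively_take[OF assms(1)], of "Suc j"] less.prems assms(2) by auto
  show ?case
  proof (cases "?d < i")
    case True
    then have "cuts (take (Suc j) p) i = 0" by (subst cuts.simps) simp
    then show ?thesis
      using cuts_take_mono[OF assms(1), of "Suc i" "Suc j" 1] less.prems by simp
  next
    case False
    \<comment> \<open>Edge \<open>i\<close> lies before the last block, so the counts after edge
      \<open>i\<close> and after edge 1 both lose exactly the cut at \<open>?d\<close>.\<close>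
    have "cuts (take (Suc j) p) r = Suc (cuts (take (Suc ?d) p) r)" if "r \<le> ?d" for r
      using d that less.prems by (intro cuts_take_Suc) auto
    moreover have "cuts (take (Suc ?d) p) i + cuts (take (Suc i) p) 1 \<le> cuts (take (Suc ?d) p) 1"
      using less.IH[of ?d] False d less.prems by simp
    ultimately show ?thesis using False assms(2) by simp
  qed
qed

section \<open>Configurations as paths with heights\<close>

text \<open>The end vertices of the horizontal edges; the start vertex and this list determine a configuration.\<close>

fun hor :: "('a \<times> nat) list \<Rightarrow> ('a \<times> nat) list" where
  "hor (u # v # x) = (if snd u = snd v then v # hor (v # x) else hor (v # x))"
| "hor _ = []"

text \<open>Passes from positions in the list to recursion along it; the next two lemmas then read
  \<open>proj_path\<close> and \<open>hor_height\<close> off \<open>hor\<close>.\<close>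

lemma map_nth_hor_indices: "map ((!) x) (hor_indices x) = hor x"
proof (induction x rule: hor.induct)
  case (1 u v x)
  have "[1..<length (u # v # x)] = 1 # map Suc [1..<length (v # x)]"
    by (simp add: upt_conv_Cons map_Suc_upt del: upt_Suc)
  then have "hor_indices (u # v # x) =
      (if snd u = snd v then [1] else []) @ map Suc (hor_indices (v # x))"
    unfolding hor_indices_def
    by (auto simp: filter_map o_def nth_Cons' simp del: upt_Suc intro!: filter_cong)
  then show ?case using 1 by (simp add: o_def)
qed (simp_all add: hor_indices_def)

lemma proj_path_eq: "proj_path x = fst (hd x) # map fst (hor x)"
  unfolding proj_path_def map_nth_hor_indices[symmetric] by simp

lemma hor_height_eq: "i < length (hor x) \<Longrightarrow> hor_height x (Suc i) = snd (hor x ! i)"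
  unfolding hor_height_def map_nth_hor_indices[symmetric] by simp

lemma hor_append: "hor (x @ u # y) = hor (x @ [u]) @ hor (u # y)"
  by (induction x rule: induct_list012) simp_all

lemma set_hor_subset: "set (hor (u # x)) \<subseteq> set x"
  by (induction x arbitrary: u) auto

text \<open>Leads from an entry of \<open>hor x\<close> back to its place in \<open>x\<close>: the
  pair of \<open>u\<close> and \<open>hor x ! i\<close> is the horizontal edge number
  \<open>i\<close>, counted from 0.\<close>

lemma hor_nth_split:
  assumes "i < length (hor x)"
  obtains y u z where "x = y @ u # hor x ! i # z" "snd u = snd (hor x ! i)"
    "length (hor (y @ [u])) = i"
proof -
  have "\<exists>y u z. x = y @ u # hor x ! i # z \<and> snd u = snd (hor x ! i) \<and> length (hor (y @ [u])) = i"
    using assms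
  proof (induction x arbitrary: i rule: hor.induct)
    case (1 u v x)
    show ?case
    proof (cases "snd u = snd v \<and> i = 0")
      case True
      then show ?thesis by (intro exI[of _ "[]"]) simp
    next
      case False
      \<comment> \<open>\<open>k\<close> is the index of the same entry within the tail.\<close>
      define k where "k = (if snd u = snd v then i - 1 else i)"
      have k: "k < length (hor (v # x))" "hor (u # v # x) ! i = hor (v # x) ! k"
        using False "1.prems" by (auto simp: k_def)
      have "\<exists>y w z. v # x = y @ w # hor (v # x) ! k # z \<and> snd w = snd (hor (v # x) ! k) \<and>
          length (hor (y @ [w])) = k"
        using "1.IH" k(1) by (cases "snd u = snd v") blast+
      then obtain y w z where *: "v # x = y @ w # hor (v # x) ! k # z"
        "snd w = snd (hor (v # x) ! k)" "length (hor (y @ [w])) = k" by blast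
      have "hd (y @ [w]) = v" using *(1) by (cases y) auto
      then obtain y' where y': "y @ [w] = v # y'" by (cases y) auto
      have "length (hor ((u # y) @ [w])) = i"
        using *(3) False y' by (auto simp: k_def)
      then show ?thesis using * k(2) by (intro exI[of _ "u # y"] exI[of _ w] exI[of _ z]) simp
    qed
  qed simp_all
  then show thesis using that by blast
qed

section \<open>Sequences of rising edges\<close>

definition rise :: "'a ugraph \<Rightarrow> 'a \<times> nat \<Rightarrow> 'a \<times> nat \<Rightarrow> bool" where
  "rise G u v \<longleftrightarrow> (snd v = snd u \<and> {fst u, fst v} \<in> edges G) \<or>
     (fst v = fst u \<and> snd v = Suc (snd u) \<and> fst u \<in> verts G)"

text \<open>Puts the monotonicity of heights into the step relation, so that edges and heights
  together become a single \<open>successively\<close> condition.\<close>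

lemma workspace_edge_iff: "{u, v} \<in> edges (workspace G) \<and> snd u \<le> snd v \<longleftrightarrow> rise G u v"
  by (cases u; cases v) (auto simp: workspace_def rise_def doubleton_eq_iff insert_commute)

lemma rise_mono: "rise G u v \<Longrightarrow> snd u \<le> snd v"
  by (auto simp: rise_def)

lemma rising_sorted: "successively (rise G) x \<Longrightarrow> sorted (map snd x)"
proof -
  assume "successively (rise G) x"
  then have "successively (\<lambda>u v. snd u \<le> snd v) x"
    by (rule successively_mono) (rule rise_mono)
  then have "sorted_wrt (\<lambda>u v. snd u \<le> snd v) x"
    by (subst successively_conv_sorted_wrt[symmetric]) (auto intro: transpI)
  then show ?thesis by (simp add: sorted_map)
qed

lemma rising_Cons_le: "successively (rise G) (u # x) \<Longrightarrow> v \<in> set x \<Longrightarrow> snd u \<le> snd v"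
  using rising_sorted[of G "u # x"] by auto

lemma sorted_hor: "successively (rise G) x \<Longrightarrow> sorted (map snd (hor x))"
proof (induction x rule: hor.induct)
  case (1 u v x)
  have "snd v \<le> snd w" if "w \<in> set (hor (v # x))" for w
    using rising_Cons_le[of G v x] "1.prems" that set_hor_subset by fastforce
  then show ?case using 1 by auto
qed simp_all

lemma last_rising:
  "successively (rise G) (u # x) \<Longrightarrow> fst (last (u # x)) = last (fst u # map fst (hor (u # x)))"
  by (induction x arbitrary: u) (auto simp: rise_def split: if_splits)

text \<open>Each edge is either horizontal or raises the height by one. Starting from height 0, the
  position of a vertex is thus its height plus the number of horizontal edges before it.\<close>

lemma length_rising:
  "successively (rise G) (u # x) \<Longrightarrow>
    snd (last (u # x)) + length (hor (u # x)) = snd u + length x"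
proof (induction x arbitrary: u)
  case (Cons v x)
  then show ?case using Cons.IH[of v] by (auto simp: rise_def)
qed simp

lemma successively_adj_hor:
  "successively (rise G) (u # x) \<Longrightarrow>
    successively (\<lambda>v w. {v, w} \<in> edges G) (fst u # map fst (hor (u # x)))"
  by (induction x arbitrary: u) (auto simp: rise_def)

lemma rising_verts:
  assumes "simple_graph G"
  shows "successively (rise G) (u # x) \<Longrightarrow> fst u \<in> verts G \<Longrightarrow> set (u # x) \<subseteq> verts G \<times> UNIV"
proof (induction x arbitrary: u)
  case (Cons v x)
  have "fst v \<in> verts G"
    using Cons.prems assms by (auto simp: rise_def simple_graph_def doubleton_eq_iff)
  then show ?case using Cons.IH[of v] Cons.prems by (simp add: mem_Times_iff)
qed (auto simp: mem_Times_iff)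

section \<open>Projected vertices, and cycle-freeness in terms of heights\<close>

lemma fst_rising_nth:
  assumes "successively (rise G) (x @ u # y)"
  shows "(fst (hd (x @ u # y)) # map fst (hor (x @ u # y))) ! length (hor (x @ [u])) = fst u"
proof -
  obtain v z where z: "x @ [u] = v # z" by (cases x) auto
  then have v: "hd (x @ u # y) = v" by (cases x) auto
  have "successively (rise G) (v # z)"
    using assms unfolding z[symmetric] by (auto simp: successively_append_iff)
  then have "fst u = last (fst v # map fst (hor (v # z)))"
    using last_rising[of G v z] by (simp flip: z)
  also have "\<dots> = (fst v # map fst (hor (v # z))) ! length (hor (x @ [u]))"
    by (subst last_conv_nth) (simp_all add: z)
  also have "\<dots> = (fst v # map fst (hor (x @ u # y))) ! length (hor (x @ [u]))"
    by (simp add: hor_append[of x u y] z nth_append nth_Cons')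
  finally show ?thesis using v by simp
qed

text \<open>Entry \<open>i\<close> of \<open>b # map fst hs\<close> is the start of edge
  \<open>i\<close>, while \<open>hs ! j\<close> gives the end of edge \<open>j\<close>. For sorted
  heights the condition excludes closed walks on a single level.\<close>

definition level_free :: "'a \<Rightarrow> ('a \<times> nat) list \<Rightarrow> bool" where
  "level_free b hs \<longleftrightarrow> (\<forall>i j. i \<le> j \<and> j < length hs \<and> snd (hs ! i) = snd (hs ! j) \<longrightarrow>
     (b # map fst hs) ! i \<noteq> fst (hs ! j))"

text \<open>Heights never decrease, so a vertex can recur only if everything between the two visits
  stays on its level; such a recurrence is a closed walk of horizontal edges.\<close>

lemma distinct_rising_iff:
  assumes r: "successively (rise G) x" and "x \<noteq> []"
  shows "distinct x \<longleftrightarrow> level_free (fst (hd x)) (hor x)"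
proof
  assume d: "distinct x"
  show "level_free (fst (hd x)) (hor x)"
    unfolding level_free_def
  proof (intro allI impI notI, elim conjE)
    fix i j
    assume ij: "i \<le> j" "j < length (hor x)" "snd (hor x ! i) = snd (hor x ! j)"
      "(fst (hd x) # map fst (hor x)) ! i = fst (hor x ! j)"
    then have "i < length (hor x)" by simp
    then obtain y u z where x: "x = y @ u # hor x ! i # z" and u: "snd u = snd (hor x ! i)"
      and i: "length (hor (y @ [u])) = i" by (rule hor_nth_split)
    have "fst u = fst (hor x ! j)"
      using fst_rising_nth[of G y u "hor x ! i # z"] r i ij(4) by (simp flip: x)
    then have eq: "u = hor x ! j" using u ij(3) by (simp add: prod_eq_iff)
    have "hor x = hor (y @ [u]) @ hor (u # hor x ! i # z)"
      using hor_append[of y u "hor x ! i # z"] by (simp only: x[symmetric])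
    then have "drop i (hor x) = hor (u # hor x ! i # z)"
      using i by (metis append_eq_conv_conj)
    moreover have "hor x ! j \<in> set (drop i (hor x))"
      using ij(1,2) by (auto simp: in_set_conv_nth intro!: exI[of _ "j - i"])
    ultimately have "hor x ! j \<in> set (hor (u # hor x ! i # z))" by simp
    then have "hor x ! j \<in> set (hor x ! i # z)" using set_hor_subset by fast
    with eq have "u \<in> set (hor x ! i # z)" by simp
    moreover have "distinct (y @ u # hor x ! i # z)" using d by (simp only: x[symmetric])
    ultimately show False by simp
  qed
next
  assume lf: "level_free (fst (hd x)) (hor x)"
  show "distinct x"
  proof (rule ccontr)
    assume "\<not> distinct x"
    then obtain y u z w where x: "x = y @ [u] @ z @ [u] @ w"
      using not_distinct_decomp by blast
    have r1: "successively (rise G) (u # z @ [u])"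
      using r unfolding x by (auto simp: successively_append_iff successively_Cons hd_append split: if_splits)
    let ?i = "length (hor (y @ [u]))" and ?j = "length (hor (y @ [u])) + length z"
    \<comment> \<open>Equal heights at both ends leave no room for a vertical edge, so all
      \<open>Suc (length z)\<close> edges are horizontal.\<close>
    have len: "length (hor (u # z @ [u])) = Suc (length z)"
      using length_rising[OF r1] by simp
    have hx: "hor x = hor (y @ [u]) @ hor (u # z @ [u]) @ hor (u # w)"
      using hor_append[of y u "z @ u # w"] hor_append[of "u # z" u w] x by simp
    have "snd v = snd u" if "v \<in> set (hor (u # z @ [u]))" for v
    proof -
      have v: "v \<in> set (z @ [u])" using that set_hor_subset by fast
      have "sorted (map snd (u # z @ [u]))" using r1 by (rule rising_sorted)
      then show ?thesis using v by (auto simp: sorted_append intro: order.antisym)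
    qed
    moreover have "hor x ! ?i = hor (u # z @ [u]) ! 0" "hor x ! ?j = hor (u # z @ [u]) ! length z"
      using hx len by (simp_all add: nth_append)
    ultimately have "snd (hor x ! ?i) = snd (hor x ! ?j)"
      using len by (metis lessI nth_mem zero_less_Suc)
    moreover have "(fst (hd x) # map fst (hor x)) ! ?i = fst u"
      using fst_rising_nth[of G y u "z @ [u] @ w"] r by (simp add: x)
    moreover have "length (hor ((y @ u # z) @ [u])) = Suc ?j"
      using hor_append[of y u "z @ [u]"] len by simp
    then have "map fst (hor x) ! ?j = fst u"
      using fst_rising_nth[of G "y @ u # z" u w] r by (simp add: x)
    moreover have "?j < length (hor x)" using hx len by simp
    ultimately show False
      using lf unfolding level_free_def by (metis le_add1 nth_map)
  qed
qed

section \<open>Reconstruction of a path from its horizontal edges\<close>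

lemma exists_rising:
  assumes "simple_graph G" "v \<in> verts G"
    and "successively (\<lambda>v w. {v, w} \<in> edges G) (v # map fst hs)"
    and "sorted (h # map snd hs)"
    and "\<forall>i < length hs. snd (hs ! i) + Suc i \<le> h + n"
  shows "\<exists>x. successively (rise G) ((v, h) # x) \<and> length x = n \<and> hor ((v, h) # x) = hs"
  using assms(2-)
proof (induction n arbitrary: v h hs)
  case 0
  then have "hs = []" by (cases hs) force+
  then show ?case by auto
next
  case (Suc n)
  \<comment> \<open>The path is forced: go horizontally while the next prescribed height is the
    current one, and rise otherwise, also after the last prescribed edge.\<close>
  show ?case
  proof (cases "hs \<noteq> [] \<and> snd (hd hs) = h")
    case True
    then obtain w hs' where hs: "hs = (w, h) # hs'" by (cases hs) auto
    have e: "{v, w} \<in> edges G" using Suc.prems(2) hs by simp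
    then have "w \<in> verts G"
      using assms(1) by (auto simp: simple_graph_def doubleton_eq_iff)
    moreover have "snd (hs' ! i) + Suc i \<le> h + n" if "i < length hs'" for i
      using Suc.prems(4)[rule_format, of "Suc i"] that hs by simp
    ultimately obtain x where x: "successively (rise G) ((w, h) # x)" "length x = n"
      "hor ((w, h) # x) = hs'"
      using Suc.IH[of w hs' h] Suc.prems hs by auto
    then show ?thesis using e hs by (intro exI[of _ "(w, h) # x"]) (simp add: rise_def)
  next
    case False
    have "sorted (Suc h # map snd hs)"
      using Suc.prems(3) False by (cases hs) auto
    then obtain x where x: "successively (rise G) ((v, Suc h) # x)" "length x = n"
      "hor ((v, Suc h) # x) = hs"
      using Suc.IH[of v hs "Suc h"] Suc.prems by auto
    then show ?thesis using Suc.prems(1)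
      by (intro exI[of _ "(v, Suc h) # x"]) (simp add: rise_def)
  qed
qed

text \<open>If one path continues horizontally and the other vertically, the second has left the
  level for good and cannot have the same first entry of \<open>hor\<close>.\<close>

lemma hor_inject:
  assumes "successively (rise G) (u # x)" "successively (rise G) (u # y)"
    and "length x = length y" "hor (u # x) = hor (u # y)"
  shows "x = y"
  using assms
proof (induction x arbitrary: u y)
  case (Cons v x)
  then obtain w z where y: "y = w # z" by (cases y) auto
  have lower: "snd u < snd p" if "successively (rise G) (u # v # x)" "snd u \<noteq> snd v"
      "p \<in> set (hor (v # x))" for v p and x :: "('a \<times> nat) list"
  proof -
    have "snd v \<le> snd p" using that rising_Cons_le[of G v x p] set_hor_subset[of v x] by auto
    then show ?thesis using that(1,2) by (auto simp: rise_def)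
  qed
  have "v = w"
  proof (cases "snd u = snd v \<longleftrightarrow> snd u = snd w")
    case True
    then show ?thesis using Cons.prems y by (auto simp: rise_def prod_eq_iff split: if_splits)
  next
    case False
    then have "v \<in> set (hor (w # z)) \<and> snd u = snd v \<or> w \<in> set (hor (v # x)) \<and> snd u = snd w"
      using Cons.prems(4) y by (auto split: if_splits) (metis list.set_intros(1))+
    then show ?thesis
      using lower[of v x w] lower[of w z v] Cons.prems(1,2) y False by auto
  qed
  then show ?case using Cons y by (auto split: if_splits)
qed simp

text \<open>By \<open>length_rising\<close>, edge \<open>i\<close>, counted from 0, ends at position
  \<open>snd (hs ! i) + Suc i\<close> of a configuration; the last condition bounds this position by
  \<open>l\<close>.\<close>

definition height_path :: "'a ugraph \<Rightarrow> 'a \<Rightarrow> nat \<Rightarrow> ('a \<times> nat) list \<Rightarrow> bool" where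
  "height_path G b l hs \<longleftrightarrow> successively (\<lambda>v w. {v, w} \<in> edges G) (b # map fst hs) \<and>
     sorted (map snd hs) \<and> level_free b hs \<and> (\<forall>i < length hs. snd (hs ! i) + Suc i \<le> l)"

section \<open>Configurations as height paths over a fixed graph\<close>

locale graph_arm =
  fixes G :: "'a ugraph" and b :: 'a and l :: nat
  assumes simple: "simple_graph G" and base: "b \<in> verts G"
begin

lemma configs_iff:
  "x \<in> configs G b l \<longleftrightarrow>
     successively (rise G) x \<and> hd x = (b, 0) \<and> length x = Suc l \<and> distinct x"
proof (cases "x \<noteq> [] \<and> hd x = (b, 0) \<and> length x = Suc l \<and> distinct x")
  case True
  have "successively (\<lambda>u v. {u, v} \<in> edges (workspace G)) x \<and> sorted (map snd x)
      \<longleftrightarrow> successively (rise G) x"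
  proof
    assume "successively (\<lambda>u v. {u, v} \<in> edges (workspace G)) x \<and> sorted (map snd x)"
    then show "successively (rise G) x"
      unfolding successively_conv_nth workspace_edge_iff[symmetric] sorted_iff_nth_mono by auto
  next
    assume r: "successively (rise G) x"
    then have "successively (\<lambda>u v. {u, v} \<in> edges (workspace G)) x"
      by (rule successively_mono) (simp add: workspace_edge_iff[symmetric])
    then show "successively (\<lambda>u v. {u, v} \<in> edges (workspace G)) x \<and> sorted (map snd x)"
      using rising_sorted[OF r] by simp
  qed
  moreover have "set x \<subseteq> verts (workspace G)" if "successively (rise G) x"
  proof -
    have "hd x # tl x = x" by (rule list.collapse) (use True in simp)
    then have "set x \<subseteq> verts G \<times> UNIV"
      using rising_verts[OF simple, of "hd x" "tl x"] that True base by simp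
    then show ?thesis by (simp add: workspace_def)
  qed
  ultimately show ?thesis using True by (auto simp: configs_def is_path_def plen_def)
qed (auto simp: configs_def is_path_def plen_def)

lemma config_ConsD:
  assumes "x \<in> configs G b l"
  shows "x = (b, 0) # tl x" "successively (rise G) ((b, 0) # tl x)" "length (tl x) = l"
  using assms by (cases x; auto simp: configs_iff)+

lemma height_path_hor:
  assumes x: "x \<in> configs G b l"
  shows "height_path G b l (hor x)"
proof -
  note c = config_ConsD[OF x]
  have r: "successively (rise G) x" using c by simp
  have "snd (hor x ! i) + Suc i \<le> l" if i: "i < length (hor x)" for i
  proof -
    obtain y u z where s: "x = y @ u # hor x ! i # z" "snd u = snd (hor x ! i)"
      "length (hor (y @ [u])) = i"
      using i by (rule hor_nth_split)
    define v where "v = hor x ! i"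
    have s': "x = (y @ [u, v]) @ z" using s(1) v_def by simp
    have "successively (rise G) (y @ [u, v])"
      using r unfolding s' by (simp only: successively_append_iff)
    moreover have "y @ [u, v] = (b, 0) # tl (y @ [u, v])" using c(1) s' by (cases y) auto
    ultimately have "snd v + length (hor (y @ [u, v])) = length (tl (y @ [u, v]))"
      using length_rising[of G "(b, 0)" "tl (y @ [u, v])"] by (metis add_0 last_snoc snd_conv append_Cons append_Nil append_assoc)
    moreover have "hor (y @ [u, v]) = hor (y @ [u]) @ [v]"
      using hor_append[of y u "[v]"] s(2) v_def by simp
    moreover have "length (tl (y @ [u, v])) \<le> l" using c(3) unfolding s' by simp
    ultimately show ?thesis using s(3) v_def by simp
  qed
  moreover have "x \<noteq> []" using c(1) by (metis list.distinct(1))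
  then have "level_free b (hor x)"
    using distinct_rising_iff[OF r] x by (auto simp: configs_iff)
  moreover have "successively (\<lambda>v w. {v, w} \<in> edges G) (b # map fst (hor x))"
    using successively_adj_hor[OF c(2)] c(1) by simp
  ultimately show ?thesis
    using sorted_hor[OF r] by (simp add: height_path_def)
qed

lemma height_path_exists:
  assumes "height_path G b l hs"
  obtains x where "x \<in> configs G b l" "hor x = hs"
proof -
  obtain x where x: "successively (rise G) ((b, 0) # x)" "length x = l" "hor ((b, 0) # x) = hs"
    using exists_rising[OF simple base, of hs 0 l] assms by (auto simp: height_path_def)
  then have "(b, 0) # x \<in> configs G b l"
    using distinct_rising_iff[OF x(1)] assms by (auto simp: configs_iff height_path_def)
  then show thesis using that x(3) by blast
qed

lemma inj_on_hor: "inj_on hor (configs G b l)"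
proof (rule inj_onI)
  fix x y assume "x \<in> configs G b l" "y \<in> configs G b l" "hor x = hor y"
  then show "x = y"
    using config_ConsD[of x] config_ConsD[of y] hor_inject[of G "(b, 0)" "tl x" "tl y"] by metis
qed

lemma adj_neq: "{v, w} \<in> edges G \<Longrightarrow> v \<noteq> w"
  using simple by (auto simp: simple_graph_def doubleton_eq_iff)

lemma adj_walk: "successively (\<lambda>v w. {v, w} \<in> edges G) p \<Longrightarrow> successively (\<noteq>) p"
  by (erule successively_mono) (simp add: adj_neq)

lemma path_iff:
  "hd p = b \<Longrightarrow> is_path G p \<longleftrightarrow> p \<noteq> [] \<and> successively (\<lambda>v w. {v, w} \<in> edges G) p"
proof -
  have "set (v # p) \<subseteq> verts G" if "successively (\<lambda>v w. {v, w} \<in> edges G) (v # p)" "v \<in> verts G"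
    for v p
    using that
  proof (induction p arbitrary: v)
    case (Cons w p)
    then have "w \<in> verts G" using simple by (auto simp: simple_graph_def doubleton_eq_iff)
    then show ?case using Cons by auto
  qed simp
  from this[of b "tl p"] base show "hd p = b \<Longrightarrow> ?thesis"
    by (cases p) (auto simp: is_path_def)
qed

end

section \<open>Consistent lower sets\<close>

text \<open>\<open>enc (p, H)\<close> is the element with path \<open>p\<close> and height \<open>H = a + n\<^sub>p - 1\<close>.\<close>

definition enc :: "'a list \<times> nat \<Rightarrow> 'a list \<times> int" where
  "enc e = (fst e, int (snd e) + 1 - int (nblocks (fst e)))"

lemma inj_enc: "inj enc"
  by (auto simp: inj_def enc_def prod_eq_iff)

lemma fst_enc [simp]: "fst (enc e) = fst e"
  by (simp add: enc_def)

text \<open>The lower set of a configuration in coordinates path and height. The bound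
  \<open>H + Suc i \<le> l\<close> is the upper bound on \<open>a\<close> in the PIP, rewritten for
  heights.\<close>

definition fan :: "'a \<Rightarrow> nat \<Rightarrow> ('a \<times> nat) list \<Rightarrow> ('a list \<times> nat) set" where
  "fan b l hs = {(take (Suc (Suc i)) (b # map fst hs), H) |i H.
     i < length hs \<and> snd (hs ! i) \<le> H \<and> H + Suc i \<le> l}"

lemma fan_length: "(q, H) \<in> fan b l hs \<Longrightarrow> 2 \<le> length q \<and> length q \<le> Suc (length hs)"
  by (auto simp: fan_def)

lemma fan_nth:
  assumes "i < length hs"
  shows "(take (Suc (Suc i)) (b # map fst hs), H) \<in> fan b l hs \<longleftrightarrow>
     snd (hs ! i) \<le> H \<and> H + Suc i \<le> l"
proof
  assume "(take (Suc (Suc i)) (b # map fst hs), H) \<in> fan b l hs"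
  then obtain j where j: "j < length hs" "snd (hs ! j) \<le> H" "H + Suc j \<le> l"
    and eq: "take (Suc (Suc i)) (b # map fst hs) = take (Suc (Suc j)) (b # map fst hs)"
    by (auto simp: fan_def)
  have "i = j" using arg_cong[OF eq, of length] j(1) assms by simp
  then show "snd (hs ! i) \<le> H \<and> H + Suc i \<le> l" using j by simp
qed (use assms in \<open>auto simp: fan_def\<close>)

text \<open>The paths in the fan give the vertices, and the least height on each path gives the
  heights. The bounds ensure that each of these least heights occurs.\<close>

lemma fan_inject:
  assumes "fan b l hs = fan b l hs'"
    and "\<forall>i < length hs. snd (hs ! i) + Suc i \<le> l" "\<forall>i < length hs'. snd (hs' ! i) + Suc i \<le> l"
  shows "hs = hs'"
proof -
  have le: "length hs' \<le> length hs \<and> (\<forall>i < length hs'. take (Suc (Suc i)) (b # map fst hs) = take (Suc (Suc i)) (b # map fst hs') \<and>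
      snd (hs ! i) \<le> snd (hs' ! i))"
    if eq: "fan b l hs = fan b l hs'" and bound: "\<forall>i < length hs'. snd (hs' ! i) + Suc i \<le> l"
    for hs hs' :: "('a \<times> nat) list"
  proof -
    have *: "i < length hs \<and> take (Suc (Suc i)) (b # map fst hs) = take (Suc (Suc i)) (b # map fst hs') \<and>
        snd (hs ! i) \<le> snd (hs' ! i)" if i: "i < length hs'" for i
    proof -
      have "(take (Suc (Suc i)) (b # map fst hs'), snd (hs' ! i)) \<in> fan b l hs"
        unfolding eq using bound i by (simp add: fan_nth del: take_Suc_Cons)
      then obtain j where j: "j < length hs" "snd (hs ! j) \<le> snd (hs' ! i)"
        and p: "take (Suc (Suc i)) (b # map fst hs') = take (Suc (Suc j)) (b # map fst hs)"
        by (auto simp: fan_def simp del: take_Suc_Cons)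
      have "i = j" using arg_cong[OF p, of length] j(1) i by simp
      then show ?thesis using j p by simp
    qed
    then have "length hs' \<le> length hs"
      by (metis leI less_irrefl)
    then show ?thesis using * by blast
  qed
  have len: "length hs = length hs'"
    using le[OF assms(1,3)] le[OF assms(1)[symmetric] assms(2)] by simp
  show ?thesis
  proof (rule nth_equalityI[OF len])
    fix i assume i: "i < length hs"
    have "take (Suc (Suc i)) (b # map fst hs) ! Suc i = take (Suc (Suc i)) (b # map fst hs') ! Suc i"
      using le[OF assms(1,3)] i len by simp
    then have "fst (hs ! i) = fst (hs' ! i)" using i len by simp
    moreover have "snd (hs ! i) = snd (hs' ! i)"
      using le[OF assms(1,3)] le[OF assms(1)[symmetric] assms(2)] i len by (simp add: order.antisym)
    ultimately show "hs ! i = hs' ! i" by (simp add: prod_eq_iff)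
  qed
qed

text \<open>At this extreme position the new edge admits the single height \<open>h\<close>. This is
  the effect of a \<open>T_up\<close> move, read backwards.\<close>

lemma fan_snoc:
  assumes "h + Suc (length hs) = l"
  shows "fan b l (hs @ [(w, h)]) = insert (b # map fst hs @ [w], h) (fan b l hs)"
  using assms
  by (force simp: fan_def nth_append less_Suc_eq)

text \<open>Raising one edge by one level removes only the lowest height on the prefix ending with
  that edge. This is the effect of a \<open>C_up\<close> move.\<close>

lemma fan_raise:
  assumes "h + Suc (length hs) \<le> l"
  shows "fan b l (hs @ (w, h) # hs') =
     insert (b # map fst hs @ [w], h) (fan b l (hs @ (w, Suc h) # hs'))"
    and "(b # map fst hs @ [w], h) \<notin> fan b l (hs @ (w, Suc h) # hs')"
proof -
  let ?p = "b # map fst (hs @ (w, h) # hs')" and ?n = "length (hs @ (w, h) # hs')"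
  let ?s = "\<lambda>i k. snd ((hs @ (w, k) # hs') ! i)"
  have t: "take (Suc (Suc (length hs))) ?p = b # map fst hs @ [w]" by simp
  have iff: "(q, H) \<in> fan b l (hs @ (w, k) # hs') \<longleftrightarrow>
      (\<exists>i < ?n. q = take (Suc (Suc i)) ?p \<and> ?s i k \<le> H \<and> H + Suc i \<le> l)" for q H k
    unfolding fan_def by auto
  have s: "?s i k = (if i = length hs then k else ?s i h)" for i k
    by (simp add: nth_append nth_Cons')
  have "(q, H) \<in> fan b l (hs @ (w, h) # hs') \<longleftrightarrow>
      (q, H) = (b # map fst hs @ [w], h) \<or> (q, H) \<in> fan b l (hs @ (w, Suc h) # hs')" for q H
  proof
    assume "(q, H) \<in> fan b l (hs @ (w, h) # hs')"
    then obtain i where i: "i < ?n" "q = take (Suc (Suc i)) ?p" "?s i h \<le> H" "H + Suc i \<le> l"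
      unfolding iff by blast
    show "(q, H) = (b # map fst hs @ [w], h) \<or> (q, H) \<in> fan b l (hs @ (w, Suc h) # hs')"
    proof (cases "i = length hs \<and> H = h")
      case True
      then show ?thesis using i(2) t by simp
    next
      case False
      then have "?s i (Suc h) \<le> H" using i(3) s[where i = i and k = "Suc h"] by auto
      then show ?thesis unfolding iff using i by blast
    qed
  next
    assume "(q, H) = (b # map fst hs @ [w], h) \<or> (q, H) \<in> fan b l (hs @ (w, Suc h) # hs')"
    then show "(q, H) \<in> fan b l (hs @ (w, h) # hs')"
    proof
      assume "(q, H) = (b # map fst hs @ [w], h)"
      then show ?thesis unfolding iff using assms t by (intro exI[of _ "length hs"]) simp
    next
      assume "(q, H) \<in> fan b l (hs @ (w, Suc h) # hs')"
      then obtain i where i: "i < ?n" "q = take (Suc (Suc i)) ?p" "?s i (Suc h) \<le> H" "H + Suc i \<le> l"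
        unfolding iff by blast
      then have "?s i h \<le> H" using s[where i = i and k = "Suc h"] by (auto split: if_splits)
      then show ?thesis unfolding iff using i by blast
    qed
  qed
  then show "fan b l (hs @ (w, h) # hs') =
     insert (b # map fst hs @ [w], h) (fan b l (hs @ (w, Suc h) # hs'))"
    by (intro set_eqI) (simp add: split_paired_all)
  show "(b # map fst hs @ [w], h) \<notin> fan b l (hs @ (w, Suc h) # hs')"
    using fan_nth[of "length hs" "hs @ (w, Suc h) # hs'" b h l] by simp
qed

text \<open>Without a cut after edge \<open>Suc i\<close>, counted from 1, that edge lies in the
  last block, so the block reaches back to vertex \<open>i\<close> at least.\<close>

lemma cuts_eq_0_distinct:
  assumes "cuts q (Suc i) = 0" "successively (\<noteq>) q" "2 \<le> length q"
  shows "distinct (drop i q)"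
  using cuts_eq_0D[OF assms] by (simp add: distinct_drop_iff)

section \<open>The PIP in terms of heights and cuts\<close>

context graph_arm
begin

abbreviation walk :: "'a list \<Rightarrow> bool" where
  "walk \<equiv> successively (\<lambda>v w. {v, w} \<in> edges G)"

text \<open>Since the number of blocks is \<open>Suc (cuts q 1)\<close>, the condition on
  \<open>H\<close> from below is \<open>0 \<le> a\<close> and the one from above is the upper bound
  on \<open>a\<close>.\<close>

lemma enc_in_elems_iff:
  "enc (q, H) \<in> IP_elems G b l \<longleftrightarrow>
     walk q \<and> hd q = b \<and> 2 \<le> length q \<and> cuts q 1 \<le> H \<and> H + plen q \<le> l"
proof (cases "walk q \<and> hd q = b \<and> 2 \<le> length q")
  case True
  then have "nblocks q = Suc (cuts q 1)" by (intro nblocks_eq adj_walk) auto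
  moreover have "q \<noteq> []" "0 < plen q" using True by (auto simp: plen_def)
  ultimately show ?thesis using True path_iff[of q]
    by (auto simp: enc_def IP_elems_def)
next
  case False
  then show ?thesis using path_iff[of q] by (auto simp: enc_def IP_elems_def plen_def)
qed

lemma elems_enc:
  assumes "e \<in> IP_elems G b l"
  obtains q H where "e = enc (q, H)"
proof -
  obtain q a where e: "e = (q, a)" by fastforce
  then have "walk q" "2 \<le> length q" "0 \<le> a" using assms path_iff[of q]
    by (auto simp: IP_elems_def plen_def)
  \<comment> \<open>At least one block makes the height \<open>a + n - 1\<close> nonnegative, so
    that it is recovered from \<open>nat\<close>.\<close>
  then have "nblocks q \<ge> 1" using nblocks_eq[OF adj_walk] by simp
  then have "e = enc (q, nat (a + int (nblocks q) - 1))"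
    using e \<open>0 \<le> a\<close> by (simp add: enc_def)
  then show thesis using that by blast
qed

text \<open>By \<open>block_index_eq\<close>, replacing \<open>a\<close> by heights turns the block
  index into the number of blocks minus the cuts, and the numbers of blocks cancel.\<close>

lemma IP_le_enc_iff:
  assumes "walk r" "2 \<le> length q"
  shows "IP_le (enc (q, H)) (enc (r, K)) \<longleftrightarrow> prefix q r \<and> K \<le> H + cuts r (plen q)"
proof (cases "prefix q r")
  case True
  then have "block_index r (plen q) + cuts r (plen q) = nblocks r"
    using assms(2) prefix_length_le[OF True]
    by (intro block_index_eq adj_walk[OF assms(1)]) (auto simp: plen_def)
  then show ?thesis using True by (auto simp: enc_def)
qed (simp add: enc_def)

lemma height_path_hd:
  assumes "height_path G b l hs"
  shows "walk (take n (b # map fst hs))" "0 < n \<Longrightarrow> hd (take n (b # map fst hs)) = b"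
  using assms successively_take[of _ "b # map fst hs" n]
  by (auto simp: height_path_def simp del: successively.simps)

text \<open>Each cut costs at least one unit of height. If the edge ending where the last block
  starts had the height of edge \<open>j\<close>, then \<open>level_free\<close> would let the
  cycle-free suffix start one vertex earlier.\<close>

lemma cuts_le_heights:
  assumes hp: "height_path G b l hs" and "i \<le> j" "j < length hs"
  shows "snd (hs ! i) + cuts (take (Suc (Suc j)) (b # map fst hs)) (Suc i) \<le> snd (hs ! j)"
  using assms(2,3)
proof (induction j rule: less_induct)
  case (less j)
  define p where "p = b # map fst hs"
  have plen: "length p = Suc (length hs)" by (simp add: p_def)
  define c where "c = cf_start (take (Suc (Suc j)) p)"
  have "walk p" using hp by (simp add: height_path_def p_def)
  then have c: "c < Suc j"
    using cf_start_less_plen[OF successively_take[OF adj_walk], of p "Suc (Suc j)"] less.prems plen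
    by (simp add: c_def)
  have mono: "snd (hs ! i) \<le> snd (hs ! k)" if "i \<le> k" "k < length hs" for i k
    using hp that by (auto simp: height_path_def sorted_iff_nth_mono)
  show ?case
  proof (cases "c < Suc i")
    case True
    then have "cuts (take (Suc (Suc j)) p) (Suc i) = 0"
      by (subst cuts.simps) (simp add: c_def)
    then show ?thesis using mono[OF less.prems] by (simp add: p_def)
  next
    case False
    \<comment> \<open>Counted from 0, edge \<open>k\<close> ends at vertex \<open>c\<close>: it is
      the last edge before the last block.\<close>
    then obtain k where k: "c = Suc k" "i \<le> k" "k < j" using c by (cases c) auto
    have "cuts (take (Suc (Suc j)) p) (Suc i) = Suc (cuts (take (Suc (Suc k)) p) (Suc i))"
      using cuts_take_Suc[of "Suc (Suc j)" p "Suc i"] less.prems plen k c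
      by (simp flip: c_def)
    moreover have "snd (hs ! i) + cuts (take (Suc (Suc k)) p) (Suc i) \<le> snd (hs ! k)"
      using less.IH[of k] k less.prems by (simp add: p_def)
    moreover have "snd (hs ! k) \<noteq> snd (hs ! j)"
    proof
      assume eq: "snd (hs ! k) = snd (hs ! j)"
      have "p ! (k + m) \<noteq> p ! (k + n)" if mn: "m < n" "n < Suc (Suc j) - k" for m n
      proof -
        \<comment> \<open>\<open>n'\<close> is the edge that ends at vertex \<open>k + n\<close>; it
          has the same height as edge \<open>k + m\<close>.\<close>
        define n' where "n' = k + n - 1"
        have n': "k + m \<le> n'" "n' \<le> j" "k + n = Suc n'" using mn k by (auto simp: n'_def)
        have "snd (hs ! (k + m)) = snd (hs ! n')"
          using mono[of k "k + m"] mono[of "k + m" n'] mono[of n' j] n' eq less.prems by simp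
        then have "p ! (k + m) \<noteq> fst (hs ! n')"
          using hp n' less.prems by (simp add: height_path_def level_free_def p_def)
        then show ?thesis using n' less.prems by (simp add: p_def)
      qed
      then have "p ! (k + m) \<noteq> p ! (k + n)"
        if "m \<noteq> n" "m < Suc (Suc j) - k" "n < Suc (Suc j) - k" for m n
        using that by (metis linorder_neqE_nat)
      then have "distinct (drop k (take (Suc (Suc j)) p))"
        using plen less.prems k by (auto simp: distinct_conv_nth)
      then have "c \<le> k" by (simp add: distinct_drop_iff c_def)
      then show False using k by simp
    qed
    moreover have "snd (hs ! k) \<le> snd (hs ! j)" using mono[of k j] k less.prems by simp
    ultimately show ?thesis by (simp add: p_def)
  qed
qed

lemma fan_elems:
  assumes hp: "height_path G b l hs" and "(q, H) \<in> fan b l hs"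
  shows "enc (q, H) \<in> IP_elems G b l"
proof -
  obtain i where i: "i < length hs" "snd (hs ! i) \<le> H" "H + Suc i \<le> l"
    and q: "q = take (Suc (Suc i)) (b # map fst hs)"
    using assms(2) by (auto simp: fan_def simp del: take_Suc_Cons)
  have "cuts q 1 \<le> H"
    using cuts_le_heights[OF hp, of 0 i] i unfolding q by (simp del: take_Suc_Cons)
  moreover have "length q = Suc (Suc i)" using i(1) unfolding q by simp
  ultimately show ?thesis
    using height_path_hd[OF hp, of "Suc (Suc i)"] i(3)
    unfolding enc_in_elems_iff q[symmetric] by (simp add: plen_def)
qed

text \<open>With \<open>j\<close> the last edge of \<open>q\<close> and \<open>i\<close> that of
  \<open>r\<close>, the height of edge \<open>j\<close> plus the cuts is at most that of edge
  \<open>i\<close>, hence at most \<open>K\<close>, hence at most \<open>H\<close> plus the same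
  cuts.\<close>

lemma below_fan:
  assumes hp: "height_path G b l hs" and r: "(r, K) \<in> fan b l hs"
    and q: "enc (q, H) \<in> IP_elems G b l" and le: "IP_le (enc (q, H)) (enc (r, K))"
  shows "(q, H) \<in> fan b l hs"
proof -
  let ?p = "b # map fst hs"
  obtain i where i: "i < length hs" "snd (hs ! i) \<le> K"
    and ri: "r = take (Suc (Suc i)) ?p"
    using r by (auto simp: fan_def simp del: take_Suc_Cons)
  have ql: "2 \<le> length q" "H + plen q \<le> l" using q by (simp_all add: enc_in_elems_iff)
  have "walk r" using height_path_hd[OF hp] ri by blast
  then have le': "prefix q r" "K \<le> H + cuts r (plen q)"
    using le by (simp_all add: IP_le_enc_iff[OF _ ql(1)])
  obtain j where j: "length q = Suc (Suc j)" using ql(1) by (metis Suc_le_D numeral_2_eq_2 Suc_le_mono)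
  have "length q \<le> length r" using le'(1) by (rule prefix_length_le)
  then have ji: "j \<le> i" using i(1) j ri by simp
  have "q = take (length q) r" using le'(1) by (metis append_eq_conv_conj prefixE)
  then have qj: "q = take (Suc (Suc j)) ?p" using j ji ri by (simp add: min_def)
  have pq: "plen q = Suc j" using j by (simp add: plen_def)
  have "snd (hs ! j) + cuts r (Suc j) \<le> snd (hs ! i)"
    using cuts_le_heights[OF hp ji i(1)] ri by simp
  then have "snd (hs ! j) \<le> H" using le'(2) i(2) pq by simp
  then show ?thesis
    unfolding qj using fan_nth[of j hs b H l] ji i(1) ql(2) pq by simp
qed

text \<open>The generators lie in the fan, which is closed downwards by \<open>below_fan\<close>;
  conversely each member lies below the generator on its own path.\<close>

lemma Sigma_map_eq_fan:
  assumes x: "x \<in> configs G b l"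
  shows "Sigma_map G b l x = enc ` fan b l (hor x)"
proof -
  let ?hs = "hor x"
  have hp: "height_path G b l ?hs" by (rule height_path_hor[OF x])
  have p: "proj_path x = b # map fst ?hs"
    using config_ConsD(1)[OF x] by (metis fst_conv list.sel(1) proj_path_eq)
  have gen: "Sigma_gen x (Suc i) = enc (take (Suc (Suc i)) (b # map fst ?hs), snd (?hs ! i))"
    if "i < length ?hs" for i
    using that by (simp add: Sigma_gen_def path_prefix_def p hor_height_eq enc_def)
  have bound: "snd (?hs ! i) + Suc i \<le> l" if "i < length ?hs" for i
    using hp that by (simp add: height_path_def)
  have "{1..plen (proj_path x)} = Suc ` {..<length ?hs}"
    by (simp add: p plen_def image_Suc_lessThan)
  then have idx: "(\<exists>i\<in>{1..plen (proj_path x)}. P i) \<longleftrightarrow> (\<exists>i < length ?hs. P (Suc i))" for P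
    by auto
  have S: "Sigma_map G b l x = {e \<in> IP_elems G b l. \<exists>i < length ?hs.
      IP_le e (enc (take (Suc (Suc i)) (b # map fst ?hs), snd (?hs ! i)))}"
    unfolding Sigma_map_def idx IP_def using gen by auto
  show ?thesis
  proof (intro equalityI subsetI)
    fix e assume "e \<in> Sigma_map G b l x"
    then obtain i where e: "e \<in> IP_elems G b l" and i: "i < length ?hs"
      and le: "IP_le e (enc (take (Suc (Suc i)) (b # map fst ?hs), snd (?hs ! i)))"
      unfolding S by blast
    obtain q H where q: "e = enc (q, H)" using e by (rule elems_enc)
    have "(take (Suc (Suc i)) (b # map fst ?hs), snd (?hs ! i)) \<in> fan b l ?hs"
      using fan_nth[OF i] bound[OF i] by blast
    then have "(q, H) \<in> fan b l ?hs"
      using below_fan[OF hp] e le q by blast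
    then show "e \<in> enc ` fan b l ?hs" using q by blast
  next
    fix e assume "e \<in> enc ` fan b l ?hs"
    then obtain i H where i: "i < length ?hs" "snd (?hs ! i) \<le> H"
      and f: "(take (Suc (Suc i)) (b # map fst ?hs), H) \<in> fan b l ?hs"
      and e: "e = enc (take (Suc (Suc i)) (b # map fst ?hs), H)"
      by (auto simp: fan_def simp del: take_Suc_Cons)
    have "IP_le e (enc (take (Suc (Suc i)) (b # map fst ?hs), snd (?hs ! i)))"
      unfolding e using i height_path_hd(1)[OF hp]
      by (subst IP_le_enc_iff) (auto simp del: take_Suc_Cons)
    then show "e \<in> Sigma_map G b l x"
      unfolding S using fan_elems[OF hp f] e i(1) by blast
  qed
qed

section \<open>Bijectivity of \<open>Sigma_map\<close>\<close>

lemma fan_con_lower: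
  assumes hp: "height_path G b l hs"
  shows "enc ` fan b l hs \<in> con_lower_sets (IP G b l)"
proof -
  have "\<not> IP_incons (enc (q, H)) (enc (r, K))"
    if "(q, H) \<in> fan b l hs" "(r, K) \<in> fan b l hs" for q H r K
  proof -
    have "prefix q (b # map fst hs)" "prefix r (b # map fst hs)"
      using that by (auto simp: fan_def take_is_prefix simp del: take_Suc_Cons)
    then show ?thesis using prefix_same_cases by (fastforce simp: enc_def)
  qed
  moreover have "y \<in> enc ` fan b l hs"
    if "(q, H) \<in> fan b l hs" "y \<in> IP_elems G b l" "IP_le y (enc (q, H))" for y q H
    using elems_enc[OF that(2)] below_fan[OF hp that(1)] that(2,3) by (metis imageI)
  ultimately show ?thesis
    using fan_elems[OF hp] by (auto simp: con_lower_sets_def IP_def)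
qed

text \<open>By consistency all paths are prefixes of a longest one. The least heights
  \<open>L\<close> on these prefixes inherit the cut inequality from closure downwards, and this
  inequality gives \<open>level_free\<close>.\<close>

lemma con_lower_is_fan:
  assumes M: "M \<in> con_lower_sets (IP G b l)"
  obtains hs where "height_path G b l hs" "M = enc ` fan b l hs"
proof (cases "M = {}")
  case True
  have "height_path G b l []" by (simp add: height_path_def level_free_def)
  then show thesis using that[of "[]"] True by (simp add: fan_def)
next
  case False
  define N where "N = {e. enc e \<in> M}"
  have elems: "enc e \<in> IP_elems G b l" if "e \<in> N" for e
    using that M by (auto simp: N_def con_lower_sets_def IP_def)
  have "M \<subseteq> IP_elems G b l" using M by (simp add: con_lower_sets_def IP_def)
  then have MN: "M = enc ` N"
    unfolding N_def using elems_enc by blast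
  have down: "(q, H) \<in> N"
    if "(r, K) \<in> N" "prefix q r" "2 \<le> length q" "K \<le> H + cuts r (plen q)"
      "cuts q 1 \<le> H" "H + plen q \<le> l" for q H r K
  proof -
    have r: "walk r" "hd r = b" "2 \<le> length r" using elems[OF that(1)] by (auto simp: enc_in_elems_iff)
    have "q = take (length q) r" using that(2) by (metis append_eq_conv_conj prefixE)
    then have "walk q" "hd q = b"
      using r that(3) successively_take[OF r(1), of "length q"]
      by (metis, metis hd_take less_le_trans zero_less_numeral)
    then have "enc (q, H) \<in> IP_elems G b l" using that by (simp add: enc_in_elems_iff)
    moreover have "IP_le (enc (q, H)) (enc (r, K))"
      using IP_le_enc_iff[OF r(1) that(3)] that by blast
    ultimately show ?thesis
      using M that(1) by (auto simp: N_def con_lower_sets_def IP_def)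
  qed
  have "\<exists>e. e \<in> N" using False MN by blast
  moreover have "\<forall>e. e \<in> N \<longrightarrow> length (fst e) < l + 2"
    using elems by (fastforce simp: enc_in_elems_iff plen_def)
  ultimately obtain e where e: "e \<in> N" "\<forall>e'. e' \<in> N \<longrightarrow> length (fst e') \<le> length (fst e)"
    using ex_has_greatest_nat[of "\<lambda>e. e \<in> N" _ "\<lambda>e. length (fst e)" "l + 2"] by blast
  obtain p K where pK: "e = (p, K)" by fastforce
  have p: "walk p" "hd p = b" "2 \<le> length p" "cuts p 1 \<le> K" "K + plen p \<le> l"
    using elems[OF e(1)] by (auto simp: pK enc_in_elems_iff)
  have pre: "prefix q p" if "(q, H) \<in> N" for q H
  proof -
    have "\<not> IP_incons (enc (q, H)) (enc (p, K))"
      using M that e(1) by (auto simp: N_def pK con_lower_sets_def IP_def)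
    then have "prefix q p \<or> prefix p q" by (auto simp: enc_def)
    moreover have "length q \<le> length p" using e(2) that pK by fastforce
    ultimately show ?thesis using prefix_length_prefix by blast
  qed
  obtain t where t: "length p = Suc t" "1 \<le> t" using p(3) by (cases p) auto
  define \<sigma> where "\<sigma> i = take (Suc (Suc i)) p" for i
  have \<sigma>: "length (\<sigma> i) = Suc (Suc i)" "plen (\<sigma> i) = Suc i" "prefix (\<sigma> i) p" if "i < t" for i
    using that t by (auto simp: \<sigma>_def plen_def take_is_prefix)
  have super: "cuts (\<sigma> j) (Suc i) + cuts (\<sigma> i) 1 \<le> cuts (\<sigma> j) 1" if "i \<le> j" "j < t" for i j
    using cuts_superadditive[OF adj_walk[OF p(1)], of "Suc i" "Suc j"] that t by (simp add: \<sigma>_def)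
  define L where "L i = (LEAST H. (\<sigma> i, H) \<in> N)" for i
  have p_last: "p = \<sigma> (t - 1)" using t by (simp add: \<sigma>_def)
  have "\<exists>H. (\<sigma> i, H) \<in> N" if i: "i < t" for i
  proof
    have "cuts p (Suc i) + cuts (\<sigma> i) 1 \<le> cuts p 1"
      using super[of i "t - 1", folded p_last] i by simp
    \<comment> \<open>This is the least height below \<open>(p, K)\<close> on the prefix; by
      \<open>super\<close> the subtraction is not truncated and the height is admissible.\<close>
    then show "(\<sigma> i, K - cuts p (Suc i)) \<in> N"
      using down[of p K "\<sigma> i" "K - cuts p (Suc i)"] e(1) p \<sigma>[OF i] pK i t by (simp add: plen_def)
  qed
  then have L: "(\<sigma> i, L i) \<in> N" if "i < t" for i
    unfolding L_def using that by (metis LeastI)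
  have L_le: "L i \<le> H" if "(\<sigma> i, H) \<in> N" for i H
    unfolding L_def using that by (rule Least_le)
  have L_cuts: "L i + cuts (\<sigma> j) (Suc i) \<le> L j" if ij: "i \<le> j" "j < t" for i j
  proof -
    have i: "i < t" using ij by simp
    have "cuts (\<sigma> j) 1 \<le> L j" "L j + Suc j \<le> l"
      using elems[OF L[OF ij(2)]] \<sigma>(2)[OF ij(2)] by (auto simp: enc_in_elems_iff)
    moreover have "prefix (\<sigma> i) (\<sigma> j)"
      using ij prefix_length_prefix[OF \<sigma>(3)[OF i] \<sigma>(3)[OF ij(2)]] \<sigma>(1)[OF i] \<sigma>(1)[OF ij(2)] by simp
    ultimately have "(\<sigma> i, L j - cuts (\<sigma> j) (Suc i)) \<in> N"
      using down[OF L[OF ij(2)], of "\<sigma> i" "L j - cuts (\<sigma> j) (Suc i)"] super[OF ij] \<sigma>[OF i] ij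
      by simp
    then have "L i \<le> L j - cuts (\<sigma> j) (Suc i)" by (rule L_le)
    then show ?thesis using \<open>cuts (\<sigma> j) 1 \<le> L j\<close> super[OF ij] by simp
  qed
  define hs where "hs = map (\<lambda>i. (p ! Suc i, L i)) [0..<t]"
  have hs: "length hs = t" "\<And>i. i < t \<Longrightarrow> hs ! i = (p ! Suc i, L i)" by (simp_all add: hs_def)
  have "p ! 0 = b" using p(2) t by (cases p) auto
  then have bp: "b # map fst hs = p"
    using t hs by (intro nth_equalityI) (auto simp: nth_Cons')
  have L_bound: "L i + Suc i \<le> l" if "i < t" for i
    using elems[OF L[OF that]] \<sigma>(2)[OF that] by (simp add: enc_in_elems_iff)
  have "level_free b hs"
    unfolding level_free_def bp hs(1)
  proof (intro allI impI, elim conjE)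
    fix i j assume ij: "i \<le> j" "j < t" "snd (hs ! i) = snd (hs ! j)"
    \<comment> \<open>Equal heights leave no room for a cut, so the vertices of
      \<open>\<sigma> j\<close> from index \<open>i\<close> on are distinct, in particular the first
      and the last of them.\<close>
    then have "cuts (\<sigma> j) (Suc i) = 0" using L_cuts[OF ij(1,2)] hs(2)[of i] hs(2)[of j] by simp
    moreover have "successively (\<noteq>) (\<sigma> j)"
      unfolding \<sigma>_def by (intro successively_take adj_walk p(1))
    ultimately have d: "distinct (drop i (\<sigma> j))"
      using \<sigma>(1)[OF ij(2)] by (intro cuts_eq_0_distinct) auto
    have "drop i (\<sigma> j) ! 0 \<noteq> drop i (\<sigma> j) ! (Suc j - i)"
      using nth_eq_iff_index_eq[OF d, of 0 "Suc j - i"] ij \<sigma>(1)[OF ij(2)] by simp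
    then show "p ! i \<noteq> fst (hs ! j)"
      using ij \<sigma>(1)[OF ij(2)] hs(2)[OF ij(2)] t by (simp add: \<sigma>_def)
  qed
  moreover have "sorted (map snd hs)"
    using L_cuts hs by (fastforce simp: sorted_iff_nth_mono)
  ultimately have "height_path G b l hs"
    using p(1) L_bound hs by (simp add: height_path_def bp)
  moreover have "N = fan b l hs"
  proof (intro equalityI subsetI)
    fix e assume eN: "e \<in> N"
    obtain q H where e: "e = (q, H)" by fastforce
    have q: "2 \<le> length q" "H + plen q \<le> l" using elems[OF eN] by (auto simp: e enc_in_elems_iff)
    obtain i where i: "length q = Suc (Suc i)" using q(1) by (metis Suc_le_D numeral_2_eq_2 Suc_le_mono)
    have "prefix q p" using pre[of q H] eN by (simp add: e)
    then have "q = take (length q) p" "length q \<le> length p"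
      by (auto simp: prefix_def)
    then have qi: "q = \<sigma> i" "i < t" using i t by (simp_all add: \<sigma>_def)
    then have "L i \<le> H" using L_le[of i H] eN by (simp add: e)
    then show "e \<in> fan b l hs"
      using fan_nth[of i hs b H l] q(2) qi hs \<sigma>(2)[of i] by (simp add: e bp \<sigma>_def)
  next
    fix e assume "e \<in> fan b l hs"
    then obtain i H where e: "e = (\<sigma> i, H)" and i: "i < t" and H: "L i \<le> H" "H + Suc i \<le> l"
      by (auto simp: fan_def bp hs \<sigma>_def simp del: take_Suc_Cons)
    have "cuts (\<sigma> i) 1 \<le> L i" using elems[OF L[OF i]] by (simp add: enc_in_elems_iff)
    then show "e \<in> N"
      using down[OF L[OF i], of "\<sigma> i" H] \<sigma>[OF i] H by (simp add: e)
  qed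
  ultimately show thesis using that MN by blast
qed

lemma bij_Sigma: "bij_betw (Sigma_map G b l) (configs G b l) (con_lower_sets (IP G b l))"
  unfolding bij_betw_def
proof (intro conjI inj_onI equalityI subsetI)
  fix x y assume xy: "x \<in> configs G b l" "y \<in> configs G b l" "Sigma_map G b l x = Sigma_map G b l y"
  then have "fan b l (hor x) = fan b l (hor y)"
    by (simp add: Sigma_map_eq_fan inj_image_eq_iff[OF inj_enc])
  then have "hor x = hor y"
    using height_path_hor[OF xy(1)] height_path_hor[OF xy(2)]
    by (intro fan_inject) (auto simp: height_path_def)
  then show "x = y" using xy inj_on_hor by (simp add: inj_on_eq_iff)
next
  fix M assume "M \<in> Sigma_map G b l ` configs G b l"
  then show "M \<in> con_lower_sets (IP G b l)"
    using fan_con_lower height_path_hor by (auto simp: Sigma_map_eq_fan)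
next
  fix M assume "M \<in> con_lower_sets (IP G b l)"
  then obtain hs where hs: "height_path G b l hs" "M = enc ` fan b l hs" by (rule con_lower_is_fan)
  then obtain x where "x \<in> configs G b l" "hor x = hs" by (metis height_path_exists)
  then show "M \<in> Sigma_map G b l ` configs G b l"
    using hs(2) Sigma_map_eq_fan by blast
qed

end

section \<open>Moves\<close>

text \<open>Replaces positions by a decomposition of the list, to which \<open>hor_append\<close>
  applies.\<close>

lemma T_step_iff:
  "T_step G b l v w h x y \<longleftrightarrow> x \<in> configs G b l \<and>
     (\<exists>z. x = z @ [(v, h), (w, h)] \<and> y = z @ [(v, h), (v, Suc h)])"
proof
  assume t: "T_step G b l v w h x y"
  then have x: "x \<in> configs G b l" and l: "1 \<le> l" and n: "x ! (l - 1) = (v, h)" "x ! l = (w, h)"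
    and y: "y = x[l := (v, Suc h)]" by (auto simp: T_step_def)
  have len: "length x = Suc l" using x l by (auto simp: configs_def plen_def)
  obtain k where k: "l = Suc k" using l by (cases l) auto
  have "drop k x = [(v, h), (w, h)]"
    using Cons_nth_drop_Suc[of k x] Cons_nth_drop_Suc[of "Suc k" x] len k n by simp
  then have xs: "x = take k x @ [(v, h), (w, h)]" by (metis append_take_drop_id)
  have "y = take k x @ [(v, h), (v, Suc h)]"
    unfolding y k using len k by (subst xs) (simp add: list_update_append)
  then show "x \<in> configs G b l \<and>
     (\<exists>z. x = z @ [(v, h), (w, h)] \<and> y = z @ [(v, h), (v, Suc h)])" using x xs by blast
next
  assume "x \<in> configs G b l \<and>
     (\<exists>z. x = z @ [(v, h), (w, h)] \<and> y = z @ [(v, h), (v, Suc h)])"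
  then obtain z where x: "x \<in> configs G b l" "x = z @ [(v, h), (w, h)]"
    "y = z @ [(v, h), (v, Suc h)]" by blast
  have "l = Suc (length z)" using x(1) by (simp add: configs_def plen_def x(2))
  then show "T_step G b l v w h x y"
    unfolding T_step_def using x by (simp add: nth_append list_update_append)
qed

lemma C_step_iff:
  "C_step G b l v w h x y \<longleftrightarrow> x \<in> configs G b l \<and> (v, Suc h) \<notin> set x \<and>
     (\<exists>z z'. x = z @ (v, h) # (w, h) # (w, Suc h) # z' \<and>
        y = z @ (v, h) # (v, Suc h) # (w, Suc h) # z')"
proof
  assume "C_step G b l v w h x y"
  then obtain j where x: "x \<in> configs G b l" and j: "1 \<le> j" "j < l"
    and n: "x ! (j - 1) = (v, h)" "x ! j = (w, h)" "x ! (j + 1) = (w, h + 1)"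
    and ns: "(v, Suc h) \<notin> set x" and y: "y = x[j := (v, Suc h)]" by (auto simp: C_step_def)
  have len: "length x = Suc l" using x j by (auto simp: configs_def plen_def)
  obtain k where k: "j = Suc k" using j by (cases j) auto
  have "drop k x = (v, h) # (w, h) # (w, Suc h) # drop (Suc (Suc (Suc k))) x"
    using Cons_nth_drop_Suc[of k x] Cons_nth_drop_Suc[of "Suc k" x]
      Cons_nth_drop_Suc[of "Suc (Suc k)" x] len j k n by simp
  then have xs: "x = take k x @ (v, h) # (w, h) # (w, Suc h) # drop (Suc (Suc (Suc k))) x"
    by (metis append_take_drop_id)
  have "y = take k x @ (v, h) # (v, Suc h) # (w, Suc h) # drop (Suc (Suc (Suc k))) x"
    unfolding y k using len j k by (subst xs) (simp add: list_update_append)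
  then show "x \<in> configs G b l \<and> (v, Suc h) \<notin> set x \<and>
     (\<exists>z z'. x = z @ (v, h) # (w, h) # (w, Suc h) # z' \<and>
        y = z @ (v, h) # (v, Suc h) # (w, Suc h) # z')" using x ns xs by blast
next
  assume "x \<in> configs G b l \<and> (v, Suc h) \<notin> set x \<and>
     (\<exists>z z'. x = z @ (v, h) # (w, h) # (w, Suc h) # z' \<and>
        y = z @ (v, h) # (v, Suc h) # (w, Suc h) # z')"
  then obtain z z' where x: "x \<in> configs G b l" "(v, Suc h) \<notin> set x"
    "x = z @ (v, h) # (w, h) # (w, Suc h) # z'"
    "y = z @ (v, h) # (v, Suc h) # (w, Suc h) # z'" by blast
  have "l = Suc (Suc (length z + length z'))"
    using x(1) by (simp add: configs_def plen_def x(3))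
  then show "C_step G b l v w h x y"
    unfolding C_step_def using x
    by (intro conjI exI[of _ "Suc (length z)"]) (simp_all add: nth_append list_update_append)
qed

section \<open>Duality and labels of moves\<close>

fun dual :: "'a move \<Rightarrow> 'a move" where
  "dual (T_up v w h) = T_down v w h"
| "dual (C_up v w h) = C_down v w h"
| "dual (T_down v w h) = T_up v w h"
| "dual (C_down v w h) = C_up v w h"

fun is_up :: "'a move \<Rightarrow> bool" where
  "is_up (T_up v w h) \<longleftrightarrow> True"
| "is_up (C_up v w h) \<longleftrightarrow> True"
| "is_up (T_down v w h) \<longleftrightarrow> False"
| "is_up (C_down v w h) \<longleftrightarrow> False"

lemma dual_dual [simp]: "dual (dual m) = m"
  by (cases m) auto

lemma is_up_dual [simp]: "is_up (dual m) \<longleftrightarrow> \<not> is_up m"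
  by (cases m) auto

lemma move_step_dual: "move_step G b l (dual m) x y \<longleftrightarrow> move_step G b l m y x"
  by (cases m) auto

text \<open>The upward move that removes \<open>e\<close>: it acts on the last edge of the path of \<open>e\<close>, whose end is vertex
  number \<open>h + plen q\<close> of the configuration.\<close>

definition lab :: "nat \<Rightarrow> 'a list \<times> int \<Rightarrow> 'a move" where
  "lab l e = (let q = fst e; h = nat (snd e + int (nblocks q) - 1) in
     (if h + plen q = l then T_up else C_up) (q ! (length q - 2)) (last q) h)"

lemma lab_enc:
  "lab l (enc (q, h)) =
     (if h + plen q = l then T_up else C_up) (q ! (length q - 2)) (last q) h"
  by (simp add: lab_def enc_def)

lemma is_up_lab: "is_up (lab l e)"
  by (simp add: lab_def Let_def)

text \<open>Heights stay constant between \<open>u\<close> and \<open>v\<close>, so \<open>v\<close>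
  is entered by a horizontal edge.\<close>

lemma hor_same_level:
  assumes "successively (rise G) (u # x)" "v \<in> set x" "snd v = snd u"
  shows "v \<in> set (hor (u # x))"
  using assms
proof (induction x arbitrary: u)
  case (Cons w x)
  have "snd w \<le> snd v" using Cons.prems rising_Cons_le[of G w x v] by auto
  moreover have "snd u \<le> snd w" using Cons.prems by (auto intro: rise_mono)
  ultimately show ?case using Cons.prems Cons.IH[of w] by auto
qed simp

lemma T_step_deterministic:
  assumes "T_step G b l v w h x y" "T_step G b l v w h x' y'"
  shows "x = x' \<longleftrightarrow> y = y'"
  using assms by (auto simp: T_step_iff)

text \<open>The position of the corner is not part of the move. It is found from
  \<open>(w, h)\<close> in \<open>x\<close> or from \<open>(v, Suc h)\<close> in \<open>y\<close>,
  where distinctness makes it unique.\<close>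

lemma C_step_deterministic:
  assumes s: "C_step G b l v w h x y" "C_step G b l v w h x' y'"
    and d: "distinct y"
  shows "x = x' \<longleftrightarrow> y = y'"
proof -
  have len: "l < length x" if "x \<in> configs G b l" for x
    using that by (cases x) (auto simp: configs_def plen_def is_path_def)
  obtain i where i: "i < l" "x ! i = (w, h)" "y = x[i := (v, Suc h)]" "x \<in> configs G b l"
    using s(1) unfolding C_step_def by (metis Suc_eq_plus1)
  then have "i < length x" using len by fastforce
  note i = this i(2-)
  obtain j where j: "j < l" "x' ! j = (w, h)" "y' = x'[j := (v, Suc h)]" "x' \<in> configs G b l"
    using s(2) unfolding C_step_def by (metis Suc_eq_plus1)
  then have "j < length x'" using len by fastforce
  note j = this j(2-)
  show ?thesis
  proof
    assume "x = x'"
    moreover have "distinct x" using i(4) by (simp add: configs_def)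
    ultimately show "y = y'" using i j by (metis nth_eq_iff_index_eq)
  next
    assume y: "y = y'"
    have "y ! i = (v, Suc h)" "y ! j = (v, Suc h)" "i < length y" "j < length y"
      using i j y by (simp, metis nth_list_update_eq, simp, metis length_list_update)
    then have "i = j" using d nth_eq_iff_index_eq by metis
    then have "y[i := (w, h)] = x" "y'[i := (w, h)] = x'" using i j by (metis list_update_id list_update_overwrite)+
    then show "x = x'" using y by simp
  qed
qed

section \<open>Effect of upward moves on the lower set\<close>

context graph_arm
begin

lemma T_step_config:
  assumes "T_step G b l v w h x y"
  shows "{v, w} \<in> edges G" "y \<in> configs G b l"
proof -
  obtain z where x: "x \<in> configs G b l" "x = z @ [(v, h), (w, h)]" "y = z @ [(v, h), (v, Suc h)]"
    using assms by (auto simp: T_step_iff)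
  have c: "successively (rise G) x" "hd x = (b, 0)" "length x = Suc l" "distinct x"
    using x(1) by (auto simp: configs_iff)
  show e: "{v, w} \<in> edges G"
    using c(1) by (simp add: x(2) successively_append_iff rise_def)
  then have "v \<in> verts G" using simple by (auto simp: simple_graph_def doubleton_eq_iff)
  then have "successively (rise G) y"
    using c(1) unfolding x(2,3) by (simp add: successively_append_iff rise_def)
  \<comment> \<open>The vertices in \<open>z\<close> precede \<open>(v, h)\<close>, so their heights
    are at most \<open>h\<close>.\<close>
  moreover have "(v, Suc h) \<notin> set z"
    using rising_sorted[OF c(1)] by (auto simp: x(2) sorted_append)
  then have "distinct y" using c(4) unfolding x(2,3) by simp
  moreover have "hd y = hd x" unfolding x(2,3) by (cases z) simp_all
  ultimately show "y \<in> configs G b l"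
    using c(2,3) unfolding configs_iff by (simp add: x(2,3))
qed

lemma C_step_config:
  assumes "C_step G b l v w h x y"
  shows "{v, w} \<in> edges G" "y \<in> configs G b l"
proof -
  obtain z z' where x: "x \<in> configs G b l" "x = z @ (v, h) # (w, h) # (w, Suc h) # z'"
    "y = z @ (v, h) # (v, Suc h) # (w, Suc h) # z'" "(v, Suc h) \<notin> set x"
    using assms by (auto simp: C_step_iff)
  have c: "successively (rise G) x" "hd x = (b, 0)" "length x = Suc l" "distinct x"
    using x(1) by (auto simp: configs_iff)
  show e: "{v, w} \<in> edges G"
    using c(1) by (auto simp: x(2) successively_append_iff rise_def)
  then have "v \<in> verts G" using simple by (auto simp: simple_graph_def doubleton_eq_iff)
  then have "successively (rise G) y"
    using c(1) e unfolding x(2,3) by (simp add: successively_append_iff rise_def)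
  moreover have "distinct y" using c(4) x(4) unfolding x(2,3) by simp
  moreover have "hd y = hd x" unfolding x(2,3) by (cases z) simp_all
  ultimately show "y \<in> configs G b l"
    using c(2,3) unfolding configs_iff by (simp add: x(2,3))
qed

lemma last_hor_prefix:
  assumes "x \<in> configs G b l" "x = z @ u # y"
  shows "last (b # map fst (hor (z @ [u]))) = fst u"
    "snd u + length (hor (z @ [u])) = length z"
proof -
  have c: "successively (rise G) (z @ [u])" "hd (z @ [u]) = (b, 0)"
    using assms by (auto simp: configs_iff successively_append_iff hd_append)
  then have "z @ [u] = (b, 0) # tl (z @ [u])" by (metis list.collapse snoc_eq_iff_butlast)
  then show "last (b # map fst (hor (z @ [u]))) = fst u"
    "snd u + length (hor (z @ [u])) = length z"
    using last_rising[of G "(b, 0)" "tl (z @ [u])"] length_rising[of G "(b, 0)" "tl (z @ [u])"] c(1)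
    by (metis fst_conv last_snoc, metis add_0 last_snoc length_tl length_append_singleton diff_Suc_1 snd_conv)
qed

text \<open>The last horizontal edge becomes vertical, so \<open>hor\<close> loses its last entry;
  that edge ends at position \<open>l\<close>, as \<open>fan_snoc\<close> requires.\<close>

lemma T_step_effect:
  assumes x: "x \<in> configs G b l" "x = z @ [(v, h), (w, h)]"
    and y: "y = z @ [(v, h), (v, Suc h)]" "y \<in> configs G b l"
    and e: "e = enc (b # map fst (hor (z @ [(v, h)])) @ [w], h)"
  shows "e \<in> Sigma_map G b l x" "Sigma_map G b l y = Sigma_map G b l x - {e}" "lab l e = T_up v w h"
proof -
  let ?hs = "hor (z @ [(v, h)])"
  have hx: "hor x = ?hs @ [(w, h)]" "hor y = ?hs"
    using hor_append[of z "(v, h)" "[(w, h)]"] hor_append[of z "(v, h)" "[(v, Suc h)]"]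
    by (simp_all add: x(2) y(1))
  note p = last_hor_prefix[OF x]
  have l: "l = Suc (length z)" using x by (simp add: configs_iff)
  then have f: "fan b l (hor x) = insert (b # map fst ?hs @ [w], h) (fan b l (hor y))"
    unfolding hx using p(2) by (intro fan_snoc) simp
  have "(b # map fst ?hs @ [w], h) \<notin> fan b l (hor y)"
    using fan_length[of "b # map fst ?hs @ [w]" h b l "hor y"] unfolding hx by auto
  then show "e \<in> Sigma_map G b l x" "Sigma_map G b l y = Sigma_map G b l x - {e}"
    unfolding Sigma_map_eq_fan[OF x(1)] Sigma_map_eq_fan[OF y(2)] f e
    using inj_enc by (auto dest: injD)
  have "(b # map fst ?hs) ! length ?hs = v"
    using p(1) by (subst (asm) last_conv_nth) simp_all
  then have "(b # map fst ?hs @ [w]) ! length ?hs = v"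
    by (metis append_Cons length_Cons length_map lessI nth_append)
  then show "lab l e = T_up v w h"
    using p(2) l by (simp add: e lab_enc plen_def)
qed

text \<open>The horizontal edge from \<open>v\<close> to \<open>w\<close> passes from level
  \<open>h\<close> to \<open>Suc h\<close> and nothing else in \<open>hor\<close> changes, so
  \<open>fan_raise\<close> applies.\<close>

lemma C_step_effect:
  assumes x: "x \<in> configs G b l" "x = z @ (v, h) # (w, h) # (w, Suc h) # z'"
    and y: "y = z @ (v, h) # (v, Suc h) # (w, Suc h) # z'" "y \<in> configs G b l"
    and e: "e = enc (b # map fst (hor (z @ [(v, h)])) @ [w], h)"
  shows "e \<in> Sigma_map G b l x" "Sigma_map G b l y = Sigma_map G b l x - {e}" "lab l e = C_up v w h"
proof -
  let ?hs = "hor (z @ [(v, h)])" and ?hs' = "hor ((w, Suc h) # z')"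
  have hx: "hor x = ?hs @ (w, h) # ?hs'" "hor y = ?hs @ (w, Suc h) # ?hs'"
    using hor_append[of z "(v, h)" "(w, h) # (w, Suc h) # z'"]
      hor_append[of z "(v, h)" "(v, Suc h) # (w, Suc h) # z'"]
    by (simp_all add: x(2) y(1))
  note p = last_hor_prefix[OF x]
  have l: "Suc (length z) < l" using x by (simp add: configs_iff)
  then have "h + Suc (length ?hs) \<le> l" using p(2) by simp
  note f = fan_raise[OF this, where b = b and w = w and hs' = ?hs', folded hx]
  show "e \<in> Sigma_map G b l x" "Sigma_map G b l y = Sigma_map G b l x - {e}"
    unfolding Sigma_map_eq_fan[OF x(1)] Sigma_map_eq_fan[OF y(2)] f(1) e
    using inj_enc f(2) by (auto dest: injD)
  have "(b # map fst ?hs) ! length ?hs = v"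
    using p(1) by (subst (asm) last_conv_nth) simp_all
  then have "(b # map fst ?hs @ [w]) ! length ?hs = v"
    by (metis append_Cons length_Cons length_map lessI nth_append)
  then show "lab l e = C_up v w h"
    using p(2) l by (simp add: e lab_enc plen_def)
qed

lemma up_step_effect:
  assumes "is_up m" "move_step G b l m x y"
  obtains e where "x \<in> configs G b l" "y \<in> configs G b l" "m \<in> moves G"
    "e \<in> Sigma_map G b l x" "Sigma_map G b l y = Sigma_map G b l x - {e}" "lab l e = m"
proof (cases m)
  case (T_up v w h)
  then have s: "T_step G b l v w h x y" using assms by simp
  obtain z where x: "x \<in> configs G b l" "x = z @ [(v, h), (w, h)]" "y = z @ [(v, h), (v, Suc h)]"
    using s by (auto simp: T_step_iff)
  note y = T_step_config(2)[OF s] and eff = T_step_effect[OF x T_step_config(2)[OF s] refl]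
  have "m \<in> moves G" using T_up T_step_config(1)[OF s] unfolding moves_def by blast
  then show thesis using T_up eff(3) by (intro that[OF x(1) y _ eff(1,2)]) simp_all
next
  case (C_up v w h)
  then have s: "C_step G b l v w h x y" using assms by simp
  obtain z z' where x: "x \<in> configs G b l" "x = z @ (v, h) # (w, h) # (w, Suc h) # z'"
    "y = z @ (v, h) # (v, Suc h) # (w, Suc h) # z'"
    using s by (auto simp: C_step_iff)
  note y = C_step_config(2)[OF s] and eff = C_step_effect[OF x C_step_config(2)[OF s] refl]
  have "m \<in> moves G" using C_up C_step_config(1)[OF s] unfolding moves_def by blast
  then show thesis using C_up eff(3) by (intro that[OF x(1) y _ eff(1,2)]) simp_all
qed (use assms in simp_all)

text \<open>Maximality makes \<open>e\<close> a generator and the cut inequality strict towards all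
  later edges. Strictness excludes both obstacles to the move: a further edge on the same level and
  an occupied vertex \<open>(v, Suc h)\<close>.\<close>

lemma up_step_exists:
  assumes x: "x \<in> configs G b l" and e: "e \<in> maximal_elems (IP G b l) (Sigma_map G b l x)"
  obtains y where "move_step G b l (lab l e) x y" "Sigma_map G b l y = Sigma_map G b l x - {e}"
proof -
  let ?hs = "hor x" and ?p = "b # map fst (hor x)"
  have hp: "height_path G b l ?hs" by (rule height_path_hor[OF x])
  have c: "successively (rise G) x" "length x = Suc l" "distinct x"
    using x by (auto simp: configs_iff)
  define \<sigma> where "\<sigma> i = take (Suc (Suc i)) ?p" for i
  have len: "length (\<sigma> i) = Suc (Suc i)" "plen (\<sigma> i) = Suc i" if "i < length ?hs" for i
    using that by (auto simp: \<sigma>_def plen_def)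
  have walk: "walk (\<sigma> i)" for i unfolding \<sigma>_def by (rule height_path_hd(1)[OF hp])
  have mem: "enc (\<sigma> i, snd (?hs ! i)) \<in> Sigma_map G b l x" if "i < length ?hs" for i
    using fan_nth[OF that, of b "snd (?hs ! i)" l] hp that
    unfolding Sigma_map_eq_fan[OF x] \<sigma>_def by (auto simp: height_path_def)
  have eS: "e \<in> Sigma_map G b l x"
    and max: "\<And>e'. e' \<in> Sigma_map G b l x \<Longrightarrow> IP_le e e' \<Longrightarrow> e' = e"
    using e by (auto simp: maximal_elems_def IP_def)
  then obtain i H where i: "i < length ?hs" "snd (?hs ! i) \<le> H" and ei: "e = enc (\<sigma> i, H)"
    unfolding Sigma_map_eq_fan[OF x] by (auto simp: fan_def \<sigma>_def simp del: take_Suc_Cons)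
  have "IP_le e (enc (\<sigma> i, snd (?hs ! i)))"
    unfolding ei using i len[OF i(1)] IP_le_enc_iff[OF walk[of i], of "\<sigma> i"] by simp
  then have ei: "e = enc (\<sigma> i, snd (?hs ! i))" using max[OF mem[OF i(1)]] by simp
  have no: "snd (?hs ! i) + cuts (\<sigma> j) (Suc i) < snd (?hs ! j)" if ij: "i < j" "j < length ?hs" for j
  proof (rule ccontr)
    assume "\<not> ?thesis"
    moreover have "prefix (\<sigma> i) (\<sigma> j)"
      unfolding \<sigma>_def using ij by (intro prefix_length_prefix[OF take_is_prefix take_is_prefix]) simp
    ultimately have "IP_le e (enc (\<sigma> j, snd (?hs ! j)))"
      unfolding ei using IP_le_enc_iff[OF walk[of j], of "\<sigma> i"] len[OF i(1)] by simp
    then have "enc (\<sigma> j, snd (?hs ! j)) = enc (\<sigma> i, snd (?hs ! i))"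
      using max[OF mem[OF ij(2)]] ei by simp
    then have "\<sigma> j = \<sigma> i" by (metis fst_conv fst_enc)
    then show False using len(1)[OF ij(2)] len(1)[OF i(1)] ij(1) by simp
  qed
  obtain z u r where xz: "x = z @ u # ?hs ! i # r" and u: "snd u = snd (?hs ! i)"
    and lz: "length (hor (z @ [u])) = i" using i(1) by (rule hor_nth_split)
  obtain v h w where uv: "u = (v, h)" "?hs ! i = (w, h)" using u by (metis prod.collapse)
  have xz: "x = z @ (v, h) # (w, h) # r" using xz uv by simp
  have hx: "?hs = hor (z @ [(v, h)]) @ (w, h) # hor ((w, h) # r)"
    using hor_append[of z "(v, h)" "(w, h) # r"] by (simp add: xz)
  have \<sigma>i: "\<sigma> i = b # map fst (hor (z @ [(v, h)])) @ [w]"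
    unfolding \<sigma>_def using lz uv by (subst hx) simp
  have ev: "e = enc (b # map fst (hor (z @ [(v, h)])) @ [w], h)"
    using ei uv by (simp add: \<sigma>i)
  show thesis
  proof (cases r)
    case Nil
    then have s: "T_step G b l v w h x (z @ [(v, h), (v, Suc h)])"
      using x xz by (auto simp: T_step_iff)
    show thesis
      using T_step_effect[OF x _ refl T_step_config(2)[OF s] ev] xz Nil s
      by (intro that[of "z @ [(v, h), (v, Suc h)]"]) simp_all
  next
    case (Cons a r')
    obtain w' h' where a: "a = (w', h')" by fastforce
    have ra: "rise G (w, h) a" and rr: "successively (rise G) (a # r')"
      using c(1) by (auto simp: xz Cons successively_append_iff)
    have "h' \<noteq> h"
    proof
      assume "h' = h"
      then have "Suc i < length ?hs \<and> snd (?hs ! Suc i) = h"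
        using a Cons lz uv by (subst (1 2) hx) (simp add: nth_append)
      then show False using no[of "Suc i"] uv by simp
    qed
    then have a: "a = (w, Suc h)" using ra a by (simp add: rise_def)
    have "(v, Suc h) \<notin> set x"
    proof
      assume "(v, Suc h) \<in> set x"
      moreover have "(v, Suc h) \<notin> set z"
        using rising_sorted[OF c(1)] by (auto simp: xz sorted_append)
      moreover have "v \<noteq> w" using c(3) xz by auto
      ultimately have "(v, Suc h) \<in> set r'" using xz a Cons by auto
      then have "(v, Suc h) \<in> set (hor (a # r'))"
        using hor_same_level[OF rr] a by simp
      moreover have "hor (a # r') = drop (Suc i) ?hs"
        using lz uv a Cons by (subst hx) simp
      \<comment> \<open>A later edge \<open>j\<close> would end at \<open>(v, Suc h)\<close>, one
        level above edge \<open>i\<close>. Strictness then forbids cuts after edge \<open>i\<close>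
        in \<open>\<sigma> j\<close>, although \<open>v\<close> occurs there at \<open>i\<close> and
        at \<open>Suc j\<close>.\<close>
      ultimately obtain j where j: "Suc i \<le> j" "j < length ?hs" "?hs ! j = (v, Suc h)"
        by (auto simp: in_set_conv_nth) (metis le_add1 add_Suc less_diff_conv add.commute)
      have "?p ! i = v"
        using fst_rising_nth[of G z "(v, h)" "(w, h) # r"] c(1) x lz uv
        by (simp add: configs_iff flip: xz)
      then have "\<sigma> j ! i = \<sigma> j ! Suc j" "i < Suc j" "Suc j < length (\<sigma> j)"
        using j len(1)[OF j(2)] by (auto simp: \<sigma>_def simp del: take_Suc_Cons)
      then have "\<not> distinct (drop i (\<sigma> j))"
        using nth_eq_iff_index_eq[of "drop i (\<sigma> j)" 0 "Suc j - i"]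
          diff_less_mono[of "Suc j" "length (\<sigma> j)" i] by auto
      then have "cuts (\<sigma> j) (Suc i) \<noteq> 0"
        using cuts_eq_0_distinct[of "\<sigma> j" i] adj_walk[OF walk[of j]] len(1)[OF j(2)] by auto
      then show False using no[of j] j uv by simp
    qed
    then have s: "C_step G b l v w h x (z @ (v, h) # (v, Suc h) # (w, Suc h) # r')"
      using x xz a Cons by (auto simp: C_step_iff)
    show thesis
      using C_step_effect[OF x _ refl C_step_config(2)[OF s] ev] xz Cons a s
      by (intro that[of "z @ (v, h) # (v, Suc h) # (w, Suc h) # r'"]) simp_all
  qed
qed

section \<open>Determinism of moves\<close>

lemma move_step_configs:
  "move_step G b l m x y \<Longrightarrow> x \<in> configs G b l \<and> y \<in> configs G b l"
  by (cases "is_up m"; use up_step_effect move_step_dual dual_dual is_up_dual in metis)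

lemma up_deterministic:
  assumes "is_up m" "move_step G b l m x y" "move_step G b l m x' y'"
  shows "x = x' \<longleftrightarrow> y = y'"
proof (cases m)
  case (C_up v w h)
  have "y \<in> configs G b l" using move_step_configs[OF assms(2)] by blast
  then show ?thesis using assms C_up C_step_deterministic[of G b l v w h x y x' y']
    by (simp add: configs_iff)
next
  case (T_up v w h)
  then show ?thesis using assms T_step_deterministic[of G b l v w h x y x' y'] by simp
qed (use assms(1) in simp_all)

lemma move_step_deterministic:
  "move_step G b l m x y \<Longrightarrow> move_step G b l m x z \<Longrightarrow> y = z"
  by (cases "is_up m") (use up_deterministic move_step_dual dual_dual is_up_dual in metis)+

text \<open>For \<open>C_up\<close> the vertex \<open>(v, Suc h)\<close> is absent before the move
  and present after it; for \<open>T_up\<close> the last height is \<open>h\<close> before and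
  \<open>Suc h\<close> after.\<close>

lemma up_down_exclusive:
  assumes "is_up m" "move_step G b l m x y" "move_step G b l m z x"
  shows False
  using assms by (cases m) (auto simp: T_step_iff C_step_iff)

end

section \<open>Cubes\<close>

lemma maximal_elems_subset:
  "N \<subseteq> M \<Longrightarrow> e \<in> N \<Longrightarrow> e \<in> maximal_elems P M \<Longrightarrow> e \<in> maximal_elems P N"
  by (auto simp: maximal_elems_def)

lemma maximal_elemsI:
  assumes "M \<in> con_lower_sets P" "e \<in> M" "M - {e} \<in> con_lower_sets P"
  shows "e \<in> maximal_elems P M"
  using assms unfolding con_lower_sets_def maximal_elems_def by blast

lemma run_moves_append:
  "run_moves G b l (ms @ ns) x z \<longleftrightarrow> (\<exists>y. run_moves G b l ms x y \<and> run_moves G b l ns y z)"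
  by (induction ms arbitrary: x) auto

text \<open>Two ways around a square: either opposite sides toggle the same element, or both ways
  lead back to \<open>M\<close>.\<close>

lemma sym_diff_singletons:
  assumes "sym_diff (sym_diff M {e1}) {f2} = sym_diff (sym_diff M {e2}) {f1}" "e1 \<noteq> e2"
  shows "f2 = e2 \<or> f2 = e1 \<and> f1 = e2"
  using assms by (auto simp: set_eq_iff)

lemma sym_diff_singleton_inject: "sym_diff M {e} = sym_diff M {f} \<longleftrightarrow> e = f"
  by (auto simp: set_eq_iff)

lemma sym_diff_insert: "a \<notin> C \<Longrightarrow> sym_diff (sym_diff M C) {a} = sym_diff M (insert a C)"
  by auto

section \<open>Elements toggled by moves\<close>

context graph_arm
begin

abbreviation "S \<equiv> Sigma_map G b l"

lemma S_eq_iff: "x \<in> configs G b l \<Longrightarrow> y \<in> configs G b l \<Longrightarrow> S x = S y \<longleftrightarrow> x = y"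
  using bij_Sigma by (auto simp: bij_betw_def inj_on_eq_iff)

lemma S_con_lower: "x \<in> configs G b l \<Longrightarrow> S x \<in> con_lower_sets (IP G b l)"
  using bij_Sigma by (auto simp: bij_betw_def)

text \<open>Symmetric difference with a singleton treats removal by upward and insertion by downward
  moves alike.\<close>

lemma move_toggles:
  assumes "move_step G b l m x y"
  obtains e where "S y = sym_diff (S x) {e}"
proof (cases "is_up m")
  case True
  then obtain e where "e \<in> S x" "S y = S x - {e}" using up_step_effect[OF _ assms] by metis
  then show thesis by (intro that[of e]) auto
next
  case False
  then obtain e where "e \<in> S y" "S x = S y - {e}"
    using up_step_effect[of "dual m" y x] assms by (metis is_up_dual move_step_dual)
  then show thesis by (intro that[of e]) auto
qed

lemma toggled_element:
  assumes m: "move_step G b l m x y" and e: "S y = sym_diff (S x) {e}"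
  shows "lab l e = (if is_up m then m else dual m)" "e \<in> S x \<longleftrightarrow> is_up m"
proof -
  have "lab l e = (if is_up m then m else dual m) \<and> (e \<in> S x \<longleftrightarrow> is_up m)"
  proof (cases "is_up m")
    case True
    then obtain f where f: "f \<in> S x" "S y = S x - {f}" "lab l f = m"
      using up_step_effect[OF _ m] by metis
    then have "sym_diff (S x) {e} = sym_diff (S x) {f}" using e by auto
    then have "e = f" by (simp only: sym_diff_singleton_inject)
    then show ?thesis using f True by simp
  next
    case False
    then obtain f where f: "f \<in> S y" "S x = S y - {f}" "lab l f = dual m"
      using up_step_effect[of "dual m" y x] m by (metis is_up_dual move_step_dual)
    from f(1,2) have "S y = sym_diff (S x) {f}" by blast
    then have "sym_diff (S x) {e} = sym_diff (S x) {f}" by (rule trans[OF e[symmetric]])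
    then have "e = f" by (simp only: sym_diff_singleton_inject)
    then show ?thesis using f False by simp
  qed
  then show "lab l e = (if is_up m then m else dual m)" "e \<in> S x \<longleftrightarrow> is_up m" by auto
qed

lemma toggled_element_inject:
  assumes "move_step G b l m x y" "S y = sym_diff (S x) {e}"
    and "move_step G b l n x z" "S z = sym_diff (S x) {e}"
  shows "m = n"
  using toggled_element[OF assms(1,2)] toggled_element[OF assms(3,4)]
  by (metis dual_dual)

text \<open>In the degenerate case of \<open>sym_diff_singletons\<close>, \<open>w = x\<close> and
  \<open>n\<close> is the dual of \<open>m\<close>. Then the upward one of the two moves both leaves
  \<open>x\<close> and arrives at \<open>x\<close>, which \<open>up_down_exclusive\<close>
  forbids.\<close>

lemma commuting_square:
  assumes s: "move_step G b l m x y" "move_step G b l n x z"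
    "move_step G b l n y w" "move_step G b l m z w" and "m \<noteq> n"
    and e: "S y = sym_diff (S x) {e}" and f: "S z = sym_diff (S x) {f}"
  shows "S w = sym_diff (S y) {f}"
proof -
  obtain f' where f': "S w = sym_diff (S y) {f'}" using s(3) by (rule move_toggles)
  obtain e' where e': "S w = sym_diff (S z) {e'}" using s(4) by (rule move_toggles)
  have "e \<noteq> f" using toggled_element_inject[OF s(1) e s(2)] f \<open>m \<noteq> n\<close> by blast
  then have "f' = f \<or> f' = e \<and> e' = f"
    using sym_diff_singletons[of "S x" e f' f e'] e f e' f' by simp
  moreover have False if "f' = e"
  proof -
    have "(if is_up m then m else dual m) = (if is_up n then n else dual n)"
      using toggled_element(1)[OF s(1) e] toggled_element(1)[OF s(3) f'] that by simp
    then have n: "n = dual m" using \<open>m \<noteq> n\<close> by (metis dual_dual)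
    have "S w = S x" using e f' that by auto
    then have "w = x" using S_eq_iff move_step_configs[OF s(1)] move_step_configs[OF s(3)] by blast
    then show False
      using up_down_exclusive[of m x y z] up_down_exclusive[of n x z y] s n
      by (metis is_up_dual)
  qed
  ultimately show ?thesis using f' by blast
qed

section \<open>Successive application of moves\<close>

lemma run_moves_deterministic:
  "run_moves G b l ms x y \<Longrightarrow> run_moves G b l ms x z \<Longrightarrow> y = z"
  by (induction ms arbitrary: x) (auto dest: move_step_deterministic)

lemma set_result_unique:
  assumes "finite A" "set_result G b l A x y" "set_result G b l A x z"
  shows "y = z"
  using finite_distinct_list[OF assms(1)] assms(2,3) run_moves_deterministic
  unfolding set_result_def by blast

lemma run_moves_configs:
  "run_moves G b l ms x y \<Longrightarrow> x \<in> configs G b l \<Longrightarrow> y \<in> configs G b l"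
  by (induction ms arbitrary: x) (auto dest: move_step_configs)

section \<open>Cubes spanned by upward moves\<close>

lemma lab_inj_on_maximal:
  assumes "x \<in> configs G b l"
  shows "inj_on (lab l) (maximal_elems (IP G b l) (S x))"
proof (rule inj_onI)
  fix e f assume ef: "e \<in> maximal_elems (IP G b l) (S x)" "f \<in> maximal_elems (IP G b l) (S x)"
    "lab l e = lab l f"
  obtain y where y: "move_step G b l (lab l e) x y" "S y = S x - {e}"
    using assms ef(1) by (rule up_step_exists)
  obtain z where z: "move_step G b l (lab l f) x z" "S z = S x - {f}"
    using assms ef(2) by (rule up_step_exists)
  have "y = z" using y(1) z(1) ef(3) move_step_deterministic by simp
  then show "e = f" using y(2) z(2) ef(1,2) by (auto simp: maximal_elems_def)
qed

text \<open>Removing one maximal element leaves the others maximal, and the label of an element does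
  not depend on the configuration.\<close>

lemma run_up_moves:
  assumes "x \<in> configs G b l" "K \<subseteq> maximal_elems (IP G b l) (S x)"
    and "distinct ms" "set ms = lab l ` K"
  shows "\<exists>y \<in> configs G b l. run_moves G b l ms x y \<and> S y = S x - K"
  using assms
proof (induction ms arbitrary: x K)
  case (Cons m ms)
  have "m \<in> lab l ` K" using Cons.prems(4) by (metis list.set_intros(1))
  then obtain e where e: "e \<in> K" "m = lab l e" by blast
  then obtain y where y: "move_step G b l m x y" "S y = S x - {e}"
    using up_step_exists[OF Cons.prems(1)] Cons.prems(2) by blast
  have "inj_on (lab l) K"
    using lab_inj_on_maximal[OF Cons.prems(1)] Cons.prems(2) by (rule inj_on_subset)
  then have "set ms = lab l ` (K - {e})"
    using Cons.prems(3,4) e by (auto simp: inj_on_image_set_diff[where C = K])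
  moreover have "K - {e} \<subseteq> maximal_elems (IP G b l) (S y)"
    using Cons.prems(2) y(2) maximal_elems_subset[of "S y" "S x"]
    by (auto simp: maximal_elems_def)
  ultimately obtain z where z: "z \<in> configs G b l" "run_moves G b l ms y z" "S z = S y - (K - {e})"
    using Cons.IH[of y "K - {e}"] Cons.prems(3) move_step_configs[OF y(1)] by auto
  then show ?case using y e(1) by (intro bexI[of _ z]) auto
qed auto

lemma up_set_result:
  assumes x: "x \<in> configs G b l" and K: "K \<subseteq> maximal_elems (IP G b l) (S x)" and fin: "finite K"
  shows "\<exists>y \<in> configs G b l. set_result G b l (lab l ` K) x y \<and> S y = S x - K"
proof -
  obtain ns where "distinct ns" "set ns = lab l ` K"
    using finite_distinct_list[of "lab l ` K"] fin by auto
  then obtain y where y: "y \<in> configs G b l" "S y = S x - K"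
    using run_up_moves[OF x K] by blast
  have "run_moves G b l ms x y" if "distinct ms" "set ms = lab l ` K" for ms
    using run_up_moves[OF x K that] y S_eq_iff by metis
  then show ?thesis using y by (auto simp: set_result_def)
qed

text \<open>An applicable upward move is the label of an element whose removal leaves a lower set,
  hence of a maximal element; so \<open>up_set_result\<close> applies.\<close>

lemma up_moves_commutative:
  assumes "finite A" "\<forall>m \<in> A. is_up m"
  shows "commutative_moves G b l A"
  unfolding commutative_moves_def
proof (intro conjI ballI impI allI)
  fix x B assume x: "x \<in> configs G b l" "\<forall>m \<in> A. applicable G b l m x" "B \<subseteq> A"
  have "\<exists>e \<in> maximal_elems (IP G b l) (S x). lab l e = m" if m: "m \<in> A" for m
  proof -
    obtain y where y: "move_step G b l m x y" using x(2) m unfolding applicable_def by blast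
    obtain e where e: "y \<in> configs G b l" "e \<in> S x" "S y = S x - {e}" "lab l e = m"
      by (rule up_step_effect[OF bspec[OF assms(2) m] y])
    have "S x - {e} \<in> con_lower_sets (IP G b l)" using S_con_lower[OF e(1)] e(3) by simp
    then have "e \<in> maximal_elems (IP G b l) (S x)"
      by (rule maximal_elemsI[OF S_con_lower[OF x(1)] e(2)])
    then show ?thesis using e(4) by blast
  qed
  then obtain E where E: "\<And>m. m \<in> A \<Longrightarrow> E m \<in> maximal_elems (IP G b l) (S x) \<and> lab l (E m) = m"
    by metis
  then have "lab l ` E ` B = B" using x(3) by (force simp: image_image)
  moreover have "finite B" using x(3) assms(1) by (rule finite_subset)
  ultimately show "\<exists>y. set_result G b l B x y"
    using up_set_result[OF x(1), of "E ` B"] E x(3) by fastforce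
qed (rule assms(1))

text \<open>The cube is spanned at its top, the configuration with lower set \<open>M\<close>, by
  the moves that remove the elements of \<open>K\<close>.\<close>

lemma up_cube:
  assumes M: "M \<in> con_lower_sets (IP G b l)"
    and K: "K \<subseteq> maximal_elems (IP G b l) M" "finite K"
  shows "\<exists>Y \<in> ccubes (config_space G b l) (card K). S ` Y = {N. M - K \<subseteq> N \<and> N \<subseteq> M}"
proof -
  have "M \<in> S ` configs G b l" using M bij_Sigma by (simp add: bij_betw_def)
  then obtain x where x: "x \<in> configs G b l" "S x = M" by blast
  have K': "K \<subseteq> maximal_elems (IP G b l) (S x)" using K x by simp
  let ?A = "lab l ` K"
  let ?Y = "{y. \<exists>B \<subseteq> ?A. set_result G b l B x y}"
  have app: "applicable G b l (lab l e) x \<and> lab l e \<in> moves G" if e: "e \<in> K" for e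
  proof -
    obtain y where y: "move_step G b l (lab l e) x y"
      using up_step_exists[OF x(1)] K' e by blast
    moreover have "lab l e \<in> moves G" using up_step_effect[OF is_up_lab y] by blast
    ultimately show ?thesis by (auto simp: applicable_def)
  qed
  have "commutative_moves G b l ?A"
    using K(2) is_up_lab by (intro up_moves_commutative) auto
  moreover have "card ?A = card K"
    using inj_on_subset[OF lab_inj_on_maximal[OF x(1)] K'] by (rule card_image)
  ultimately have "?Y \<in> ccubes (config_space G b l) (card K)"
    unfolding config_space_def using x(1) app
    by (auto intro!: exI[of _ ?A] exI[of _ x])
  moreover have "S ` ?Y = {N. M - K \<subseteq> N \<and> N \<subseteq> M}"
  proof (intro equalityI subsetI)
    fix N assume "N \<in> S ` ?Y"
    then obtain y B where y: "B \<subseteq> ?A" "set_result G b l B x y" "N = S y" by blast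
    obtain L where L: "L \<subseteq> K" "B = lab l ` L" using y(1) by (metis subset_image_iff)
    have fin: "finite L" using L(1) K(2) by (rule finite_subset)
    obtain z where "set_result G b l B x z" "S z = S x - L"
      using up_set_result[OF x(1) _ fin] L K' by blast
    then have "N = M - L" using set_result_unique[of B] y L(2) fin x(2) by blast
    then show "N \<in> {N. M - K \<subseteq> N \<and> N \<subseteq> M}" using L(1) by blast
  next
    fix N assume N: "N \<in> {N. M - K \<subseteq> N \<and> N \<subseteq> M}"
    let ?L = "M - N"
    have L: "?L \<subseteq> K" using N by blast
    then have "finite ?L" using K(2) by (rule finite_subset)
    then obtain y where y: "set_result G b l (lab l ` ?L) x y" "S y = S x - ?L"
      using up_set_result[OF x(1), of ?L] L K' by blast
    have "lab l ` ?L \<subseteq> ?A" using L by (rule image_mono)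
    then have "y \<in> ?Y" using y(1) by (intro CollectI exI[of _ "lab l ` ?L"] conjI)
    moreover have "M - ?L = N" using N by blast
    then have "N = S y" unfolding y(2) x(2) by (rule sym)
    ultimately show "N \<in> S ` ?Y" by blast
  qed
  ultimately show ?thesis by blast
qed

lemma config_cube:
  assumes comm: "commutative_moves G b l A" and x: "x \<in> configs G b l"
    and app: "\<forall>m \<in> A. applicable G b l m x"
  shows "\<exists>M K. S ` {y. \<exists>B \<subseteq> A. set_result G b l B x y} = {N. M - K \<subseteq> N \<and> N \<subseteq> M} \<and>
     M \<in> con_lower_sets (IP G b l) \<and> K \<subseteq> maximal_elems (IP G b l) M \<and> finite K \<and> card K = card A"
proof -
  have fin: "finite A" using comm by (simp add: commutative_moves_def)
  have "\<forall>B. \<exists>y. B \<subseteq> A \<longrightarrow> set_result G b l B x y"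
    using comm x app unfolding commutative_moves_def by blast
  then obtain Y where Y: "\<And>B. B \<subseteq> A \<Longrightarrow> set_result G b l B x (Y B)" by metis
  have finB: "finite B" if "B \<subseteq> A" for B using that fin by (rule finite_subset)
  have Y0: "Y {} = x" using Y[of "{}"] by (auto simp: set_result_def)
  have Y_config: "Y B \<in> configs G b l" if "B \<subseteq> A" for B
    using Y[OF that] finite_distinct_list[OF finB[OF that]] run_moves_configs[OF _ x]
    unfolding set_result_def by blast
  \<comment> \<open>Compare an order of \<open>insert m B\<close> in which \<open>m\<close> comes
    last with the order of \<open>B\<close> before it.\<close>
  have Y_step: "move_step G b l m (Y B) (Y (insert m B))" if m: "insert m B \<subseteq> A" "m \<notin> B" for m B
  proof -
    have B: "B \<subseteq> A" using m by simp
    obtain ms where ms: "set ms = B" "distinct ms" using finite_distinct_list[OF finB[OF B]] by blast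
    have "run_moves G b l ms x (Y B)" using Y[OF B] ms by (simp add: set_result_def)
    moreover have "run_moves G b l (ms @ [m]) x (Y (insert m B))"
      using Y[OF m(1)] ms m(2) by (simp add: set_result_def)
    ultimately show ?thesis
      using run_moves_deterministic by (auto simp: run_moves_append)
  qed
  have "\<exists>e. S (Y {m}) = sym_diff (S x) {e}" if "m \<in> A" for m
    using that move_toggles Y_step[of m "{}"] Y0 by (metis empty_iff empty_subsetI insert_subset)
  then obtain E where E: "\<And>m. m \<in> A \<Longrightarrow> S (Y {m}) = sym_diff (S x) {E m}" by metis
  have step1: "move_step G b l m x (Y {m})" if "m \<in> A" for m
    using Y_step[of m "{}"] that Y0 by simp
  have injE: "inj_on E A"
    using toggled_element_inject[OF step1 E step1] E by (metis inj_onI)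
  \<comment> \<open>The second conjunct is carried along because \<open>commuting_square\<close>
    needs the toggled elements of both sides leaving \<open>Y B\<close>.\<close>
  have main: "S (Y B) = sym_diff (S x) (E ` B) \<and>
      (\<forall>m \<in> A - B. S (Y (insert m B)) = sym_diff (S (Y B)) {E m})" if "B \<subseteq> A" for B
    using finB[OF that] that
  proof (induction B rule: finite_induct)
    case empty
    then show ?case using E Y0 by simp
  next
    case (insert m B)
    have IH: "S (Y B) = sym_diff (S x) (E ` B)"
      "\<And>n. n \<in> A \<Longrightarrow> n \<notin> B \<Longrightarrow> S (Y (insert n B)) = sym_diff (S (Y B)) {E n}"
      using insert by auto
    have "E m \<notin> E ` B" using injE insert.prems insert.hyps(2) by (auto simp: inj_on_def)
    then have "sym_diff (sym_diff (S x) (E ` B)) {E m} = sym_diff (S x) (E ` insert m B)"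
      unfolding image_insert by (rule sym_diff_insert)
    moreover have "S (Y (insert m B)) = sym_diff (sym_diff (S x) (E ` B)) {E m}"
      using IH(2)[of m] insert.prems insert.hyps(2) unfolding IH(1) by simp
    ultimately have "S (Y (insert m B)) = sym_diff (S x) (E ` insert m B)" by (rule trans[rotated])
    moreover have "S (Y (insert n (insert m B))) = sym_diff (S (Y (insert m B))) {E n}"
      if n: "n \<in> A - insert m B" for n
    proof (rule commuting_square)
      show "move_step G b l m (Y B) (Y (insert m B))" "move_step G b l n (Y B) (Y (insert n B))"
        using insert n by (auto intro!: Y_step)
      show "move_step G b l n (Y (insert m B)) (Y (insert n (insert m B)))"
        using insert n by (auto intro!: Y_step)
      show "move_step G b l m (Y (insert n B)) (Y (insert n (insert m B)))"
        using insert n Y_step[of m "insert n B"] by (auto simp: insert_commute)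
      show "m \<noteq> n" using n by blast
    qed (use IH(2) insert n in auto)
    ultimately show ?case by blast
  qed
  have Y_iff: "set_result G b l B x y \<longleftrightarrow> y = Y B" if "B \<subseteq> A" for B y
    using Y[OF that] set_result_unique[OF finB[OF that]] by blast
  have toggles: "sym_diff (S x) L \<in> con_lower_sets (IP G b l)" if L: "L \<subseteq> E ` A" for L
  proof -
    obtain B where B: "B \<subseteq> A" "L = E ` B" using L by (metis subset_image_iff)
    then show ?thesis using main[OF B(1)] S_con_lower[OF Y_config[OF B(1)]] by simp
  qed
  let ?K = "E ` A"
  let ?M = "S x \<union> ?K"
  have M: "?M \<in> con_lower_sets (IP G b l)"
  proof -
    have "sym_diff (S x) (?K - S x) = ?M" by blast
    then show ?thesis using toggles[of "?K - S x"] by auto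
  qed
  moreover have "?K \<subseteq> maximal_elems (IP G b l) ?M"
  proof
    fix e assume e: "e \<in> ?K"
    \<comment> \<open>The top with \<open>e\<close> removed is also among the lower sets reached,
      which forces \<open>e\<close> to be maximal in the top.\<close>
    have "sym_diff (S x) (sym_diff (?K - S x) {e}) = ?M - {e}" using e by blast
    moreover have "sym_diff (?K - S x) {e} \<subseteq> ?K" using e by blast
    ultimately have "?M - {e} \<in> con_lower_sets (IP G b l)" using toggles by metis
    then show "e \<in> maximal_elems (IP G b l) ?M" using maximal_elemsI[OF M] e by blast
  qed
  moreover have "S ` {y. \<exists>B \<subseteq> A. set_result G b l B x y} = {N. ?M - ?K \<subseteq> N \<and> N \<subseteq> ?M}"
  proof (intro equalityI subsetI)
    fix N assume "N \<in> S ` {y. \<exists>B \<subseteq> A. set_result G b l B x y}"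
    then obtain y B where y: "N = S y" and B: "B \<subseteq> A" "set_result G b l B x y"
      by (elim imageE CollectE exE conjE)
    then have "N = S (Y B)" using Y_iff[OF B(1)] by simp
    with B(1) have "N = sym_diff (S x) (E ` B)" "E ` B \<subseteq> ?K" using main by auto
    then show "N \<in> {N. ?M - ?K \<subseteq> N \<and> N \<subseteq> ?M}" by blast
  next
    fix N assume N: "N \<in> {N. ?M - ?K \<subseteq> N \<and> N \<subseteq> ?M}"
    have "sym_diff (S x) N \<subseteq> ?K" using N by blast
    then obtain B where B: "B \<subseteq> A" "sym_diff (S x) N = E ` B" by (metis subset_image_iff)
    have "N = sym_diff (S x) (sym_diff (S x) N)" by blast
    then have "N = S (Y B)" using main[OF B(1)] B(2) by simp
    moreover have "Y B \<in> {y. \<exists>B \<subseteq> A. set_result G b l B x y}"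
      using B(1) Y[OF B(1)] by (intro CollectI exI[of _ B] conjI)
    ultimately show "N \<in> S ` {y. \<exists>B \<subseteq> A. set_result G b l B x y}" by (rule image_eqI)
  qed
  moreover have "card ?K = card A" using injE by (rule card_image)
  ultimately show ?thesis using fin by blast
qed

text \<open>A cube of the PIP is the image of some cube \<open>Y\<close> by \<open>up_cube\<close>,
  and injectivity of \<open>S\<close> identifies \<open>Y\<close> with the given set.\<close>

lemma cubical_iso_Sigma: "cubical_iso S (config_space G b l) (pip_complex (IP G b l))"
  unfolding cubical_iso_def
proof (intro conjI allI impI)
  show "bij_betw S (cverts (config_space G b l)) (cverts (pip_complex (IP G b l)))"
    using bij_Sigma by (simp add: config_space_def pip_complex_def)
  fix k Z assume "Z \<subseteq> cverts (config_space G b l)"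
  then have Z: "Z \<subseteq> configs G b l" by (simp add: config_space_def)
  show "Z \<in> ccubes (config_space G b l) k \<longleftrightarrow> S ` Z \<in> ccubes (pip_complex (IP G b l)) k"
  proof
    assume "Z \<in> ccubes (config_space G b l) k"
    then obtain A x where A: "commutative_moves G b l A" "x \<in> configs G b l"
      "\<forall>m \<in> A. applicable G b l m x" "card A = k" and Z: "Z = {y. \<exists>B \<subseteq> A. set_result G b l B x y}"
      by (auto simp: config_space_def)
    show "S ` Z \<in> ccubes (pip_complex (IP G b l)) k"
      using config_cube[OF A(1-3)] A(4) unfolding Z pip_complex_def by simp
  next
    assume "S ` Z \<in> ccubes (pip_complex (IP G b l)) k"
    then have "\<exists>M K. S ` Z = {N. M - K \<subseteq> N \<and> N \<subseteq> M} \<and> M \<in> con_lower_sets (IP G b l) \<and>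
        K \<subseteq> maximal_elems (IP G b l) M \<and> finite K \<and> card K = k"
      by (simp add: pip_complex_def)
    then obtain M K where "S ` Z = {N. M - K \<subseteq> N \<and> N \<subseteq> M}" "M \<in> con_lower_sets (IP G b l)"
      "K \<subseteq> maximal_elems (IP G b l) M" "finite K" "card K = k"
      by (elim exE conjE) (rule that)
    then obtain Y where Y: "Y \<in> ccubes (config_space G b l) k" "S ` Y = S ` Z"
      using up_cube[of M K] by auto
    \<comment> \<open>Injectivity of \<open>S\<close> is available on configurations, so the members
      of \<open>Y\<close> must be known to be such.\<close>
    have "Y \<subseteq> configs G b l"
    proof
      fix y assume "y \<in> Y"
      then obtain A x B where A: "commutative_moves G b l A" "x \<in> configs G b l" "B \<subseteq> A"
        "set_result G b l B x y"
        using Y(1) by (auto simp: config_space_def)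
      have "finite B" using A(1,3) by (auto simp: commutative_moves_def intro: finite_subset)
      then obtain ms where "set ms = B" "distinct ms" using finite_distinct_list by blast
      then have "run_moves G b l ms x y" using A(4) by (simp add: set_result_def)
      then show "y \<in> configs G b l" using A(2) by (rule run_moves_configs)
    qed
    then have "Y = Z" using Y(2) Z bij_Sigma by (meson bij_betw_def inj_on_image_eq_iff)
    then show "Z \<in> ccubes (config_space G b l) k" using Y(1) by simp
  qed
qed

end

theorem theorem4p9:
  fixes G :: "'a ugraph" and b :: 'a and l :: nat
  assumes "simple_graph G" and "connected_graph G" and "b \<in> verts G"
  shows "cubical_iso (Sigma_map G b l) (config_space G b l) (pip_complex (IP G b l))"
proof -
  interpret graph_arm G b l using assms by unfold_locales
  show ?thesis by (rule cubical_iso_Sigma)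
qed

end
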